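(* Let $N\ge2$ be an integer, and let $i_0(x,y)=(y,x)$. The $i_0$-symmetric flows of level $N$ (i.e. flows $\phi$ of level $N$ with $i_0\circ\phi\circ i_0=\phi$) are exactly the flows $$\phi=\ell^{-1}\circ\Phi_{\pm N}\circ\ell,$$ where $\ell(x,y)=(xA(x,y),yA(x,y))$ for any non-zero $0$-homogeneous rational function $A\in\mathbb{R}(x,y)$ which is symmetric, $A(x,y)=A(y,x)$, and where, for $M\in\{N,-N\}$, $$\Phi_{M}(x,y)=\Big(\frac{(x+y+1)^{M}(x+y)+x-y}{2(x+y+1)^{M+1}},\ \frac{(x+y+1)^{M}(x+y)+y-x}{2(x+y+1)^{M+1}}\Big).$$
   Context: A flow is a pair $\phi=(u,v)$ of rational functions in $\mathbb{R}(x,y)$, $\phi\ne(x,y)$, satisfying, as identities of rational functions, $(1-z)\phi(\mathbf{x})=\phi\big(\phi(\mathbf{x}z)\frac{1-z}{z}\big)$ and $\lim_{z\to0}\phi(\mathbf{x}z)/z=\mathbf{x}$, where $\mathbf{x}=(x,y)$. A $1$-BIR is a birational plane transformation over $\mathbb{R}$ whose two coordinates are homogeneous rational functions of degree $1$. The level of a flow $\phi$ is the unique integer $N\ge 0$ such that $\phi=\ell^{-1}\circ\phi_N\circ\ell$ for some $1$-BIR $\ell$, where $\phi_N(x,y)=\big(x(y+1)^{N-1},\frac{y}{y+1}\big)$. $0$-homogeneous means homogeneous of degree $0$. *)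

theory Defs
  imports "HOL-Computational_Algebra.Computational_Algebra"
begin

text \<open>
  \<open>ratfun\<close> is the field \<open>\<real>(x,y)\<close>, built as the fraction field of \<open>\<real>[x][y]\<close> (the outer
  polynomial variable is \<open>y\<close>). \<open>ratfun3\<close> is \<open>\<real>(x,y,z)\<close>, built as \<open>\<real>(x,y)(z)\<close>.
\<close>

type_synonym ratfun = "real poly poly fract"
type_synonym ratfun3 = "ratfun poly fract"
type_synonym ratmap = "ratfun \<times> ratfun"

definition const2 :: "real \<Rightarrow> ratfun" where
  "const2 r = to_fract [:[:r:]:]"

definition X :: ratfun where
  "X = to_fract [:[:0, 1:]:]"

definition Y :: ratfun where
  "Y = to_fract [:0, 1:]"

definition emb :: "ratfun \<Rightarrow> ratfun3" where
  "emb f = to_fract [:f:]"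

definition Z :: ratfun3 where
  "Z = to_fract [:0, 1:]"

definition const3 :: "real \<Rightarrow> ratfun3" where
  "const3 r = emb (const2 r)"


text \<open>
  Substitution of a pair \<open>(a,b)\<close> of elements of a field extension \<open>h :: \<real> \<rightarrow> K\<close> into
  polynomials and rational functions. The value of \<open>f = P/Q\<close> at \<open>(a,b)\<close> is
  \<open>P(a,b)/Q(a,b)\<close> for any representation whose denominator does not vanish at \<open>(a,b)\<close>;
  \<open>f\<close> is defined at \<open>(a,b)\<close> iff there is one.
\<close>

definition eval_poly2 :: "(real \<Rightarrow> 'k::field) \<Rightarrow> real poly poly \<Rightarrow> 'k \<times> 'k \<Rightarrow> 'k" where
  "eval_poly2 h P p = poly (map_poly (\<lambda>c. poly (map_poly h c) (fst p)) P) (snd p)"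

definition rf_defined :: "(real \<Rightarrow> 'k::field) \<Rightarrow> ratfun \<Rightarrow> 'k \<times> 'k \<Rightarrow> bool" where
  "rf_defined h f p \<longleftrightarrow> (\<exists>P Q. f = Fract P Q \<and> eval_poly2 h Q p \<noteq> 0)"

definition rf_value :: "(real \<Rightarrow> 'k::field) \<Rightarrow> ratfun \<Rightarrow> 'k \<times> 'k \<Rightarrow> 'k" where
  "rf_value h f p =
     (THE c. \<exists>P Q. f = Fract P Q \<and> eval_poly2 h Q p \<noteq> 0 \<and>
                   c = eval_poly2 h P p / eval_poly2 h Q p)"

lemma map_poly_mult_hom:
  fixes g :: "'a::comm_ring_1 \<Rightarrow> 'b::comm_ring_1"
  assumes "g 0 = 0" "\<And>a b. g (a + b) = g a + g b" "\<And>a b. g (a * b) = g a * g b"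
  shows "map_poly g (p * q) = map_poly g p * map_poly g q"
proof (rule poly_eqI)
  fix n
  have gsum: "g (sum f A) = (\<Sum>i\<in>A. g (f i))" for f :: "nat \<Rightarrow> 'a" and A
    by (induction A rule: infinite_finite_induct) (use assms in auto)
  show "coeff (map_poly g (p * q)) n = coeff (map_poly g p * map_poly g q) n"
    by (simp add: coeff_map_poly coeff_mult assms gsum)
qed

lemma map_poly_add_hom:
  fixes g :: "'a::comm_ring_1 \<Rightarrow> 'b::comm_ring_1"
  assumes "g 0 = 0" "\<And>a b. g (a + b) = g a + g b"
  shows "map_poly g (p + q) = map_poly g p + map_poly g q"
  by (rule poly_eqI) (simp add: coeff_map_poly assms)

lemma eval_poly2_mult:
  assumes "h 0 = 0" "\<And>a b. h (a + b) = h a + h b" "\<And>a b. h (a * b) = h a * h b"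
  shows "eval_poly2 h (P * Q) p = eval_poly2 h P p * eval_poly2 h Q p"
proof -
  let ?g = "\<lambda>c. poly (map_poly h c) (fst p)"
  have "map_poly ?g (P * Q) = map_poly ?g P * map_poly ?g Q"
    by (rule map_poly_mult_hom)
      (simp_all add: map_poly_mult_hom[of h] map_poly_add_hom[of h] assms)
  then show ?thesis
    by (simp add: eval_poly2_def)
qed

text \<open>The value does not depend on the representation.\<close>

lemma rf_value_Fract:
  assumes h: "h 0 = 0" "\<And>a b. h (a + b) = h a + h b" "\<And>a b. h (a * b) = h a * h b"
    and Q: "eval_poly2 h Q p \<noteq> 0"
  shows "rf_value h (Fract P Q) p = eval_poly2 h P p / eval_poly2 h Q p"
  unfolding rf_value_def
proof (rule the_equality)
  fix c
  assume "\<exists>P' Q'. Fract P Q = Fract P' Q' \<and> eval_poly2 h Q' p \<noteq> 0 \<and>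
                  c = eval_poly2 h P' p / eval_poly2 h Q' p"
  then obtain P' Q' where *: "Fract P Q = Fract P' Q'" "eval_poly2 h Q' p \<noteq> 0"
    "c = eval_poly2 h P' p / eval_poly2 h Q' p" by blast
  have "Q \<noteq> 0" "Q' \<noteq> 0" using Q *(2) by (auto simp: eval_poly2_def)
  then have "P * Q' = P' * Q" using *(1) by (simp add: eq_fract)
  then have "eval_poly2 h P p * eval_poly2 h Q' p = eval_poly2 h P' p * eval_poly2 h Q p"
    using eval_poly2_mult[of h, OF h] by metis
  then show "c = eval_poly2 h P p / eval_poly2 h Q p"
    using Q *(2) unfolding *(3) by (simp add: frac_eq_eq)
qed (use Q in blast)

lemma const2_hom:
  "const2 0 = 0" "const2 1 = 1" "const2 (a + b) = const2 a + const2 b"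
  "const2 (a * b) = const2 a * const2 b"
  by (simp_all add: const2_def flip: to_fract_add to_fract_mult one_pCons)

lemma const3_hom:
  "const3 0 = 0" "const3 1 = 1" "const3 (a + b) = const3 a + const3 b"
  "const3 (a * b) = const3 a * const3 b"
  by (simp_all add: const3_def emb_def const2_hom flip: to_fract_add to_fract_mult one_pCons)

definition map_defined :: "(real \<Rightarrow> 'k::field) \<Rightarrow> ratmap \<Rightarrow> 'k \<times> 'k \<Rightarrow> bool" where
  "map_defined h \<phi> p \<longleftrightarrow> rf_defined h (fst \<phi>) p \<and> rf_defined h (snd \<phi>) p"

definition map_value :: "(real \<Rightarrow> 'k::field) \<Rightarrow> ratmap \<Rightarrow> 'k \<times> 'k \<Rightarrow> 'k \<times> 'k" where
  "map_value h \<phi> p = (rf_value h (fst \<phi>) p, rf_value h (snd \<phi>) p)"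

text \<open>
  \<open>\<phi> \<circ>\<^sub>R \<psi>\<close> is meaningful only when \<open>map_defined const2 \<phi> \<psi>\<close>; this always holds when the
  components of \<open>\<psi>\<close> are algebraically independent, in particular when \<open>\<psi>\<close> is birational.
\<close>

definition rcomp :: "ratmap \<Rightarrow> ratmap \<Rightarrow> ratmap" (infixl "\<circ>\<^sub>R" 55) where
  "\<phi> \<circ>\<^sub>R \<psi> = map_value const2 \<phi> \<psi>"

definition inverse_maps :: "ratmap \<Rightarrow> ratmap \<Rightarrow> bool" where
  "inverse_maps l m \<longleftrightarrow>
     map_defined const2 l m \<and> l \<circ>\<^sub>R m = (X, Y) \<and>
     map_defined const2 m l \<and> m \<circ>\<^sub>R l = (X, Y)"

definition birational :: "ratmap \<Rightarrow> bool" where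
  "birational l \<longleftrightarrow> (\<exists>m. inverse_maps l m)"

definition rinv :: "ratmap \<Rightarrow> ratmap" where
  "rinv l = (THE m. inverse_maps l m)"


text \<open>\<open>f(xz, yz) = z\<^sup>d f(x, y)\<close> in \<open>\<real>(x,y,z)\<close>; the left side is defined for every \<open>f\<close>.\<close>

definition homogeneous :: "int \<Rightarrow> ratfun \<Rightarrow> bool" where
  "homogeneous d f \<longleftrightarrow> rf_value const3 f (emb X * Z, emb Y * Z) = Z powi d * emb f"

definition one_BIR :: "ratmap \<Rightarrow> bool" where
  "one_BIR l \<longleftrightarrow> birational l \<and> homogeneous 1 (fst l) \<and> homogeneous 1 (snd l)"

definition symmetric :: "ratfun \<Rightarrow> bool" where
  "symmetric A \<longleftrightarrow> rf_value const2 A (Y, X) = A"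


definition scale :: "ratfun3 \<Rightarrow> ratfun3 \<times> ratfun3 \<Rightarrow> ratfun3 \<times> ratfun3" where
  "scale c p = (c * fst p, c * snd p)"

text \<open>
  The limit at \<open>z = 0\<close> of a rational function in \<open>z\<close> with coefficients in \<open>\<real>(x,y)\<close>, as a
  rational function of \<open>x, y\<close>: it exists iff the function has no pole at \<open>z = 0\<close>, and is then
  its value there.
\<close>

definition has_limit0 :: "ratfun3 \<Rightarrow> ratfun \<Rightarrow> bool" where
  "has_limit0 g c \<longleftrightarrow> (\<exists>P Q. g = Fract P Q \<and> poly Q 0 \<noteq> 0 \<and> c = poly P 0 / poly Q 0)"

definition at_xz :: "ratmap \<Rightarrow> ratfun3 \<times> ratfun3" where
  "at_xz \<phi> = map_value const3 \<phi> (emb X * Z, emb Y * Z)"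

definition flow :: "ratmap \<Rightarrow> bool" where
  "flow \<phi> \<longleftrightarrow>
     \<phi> \<noteq> (X, Y) \<and>
     map_defined const3 \<phi> (scale ((1 - Z) / Z) (at_xz \<phi>)) \<and>
     scale (1 - Z) (emb (fst \<phi>), emb (snd \<phi>)) =
       map_value const3 \<phi> (scale ((1 - Z) / Z) (at_xz \<phi>)) \<and>
     has_limit0 (fst (at_xz \<phi>) / Z) X \<and>
     has_limit0 (snd (at_xz \<phi>) / Z) Y"

definition phi :: "int \<Rightarrow> ratmap" where
  "phi N = (X * (Y + 1) powi (N - 1), Y / (Y + 1))"

definition has_level :: "ratmap \<Rightarrow> int \<Rightarrow> bool" where
  "has_level \<phi> N \<longleftrightarrow> flow \<phi> \<and> N \<ge> 0 \<and> (\<exists>l. one_BIR l \<and> \<phi> = rinv l \<circ>\<^sub>R phi N \<circ>\<^sub>R l)"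

definition i0 :: ratmap where
  "i0 = (Y, X)"

definition Phi :: "int \<Rightarrow> ratmap" where
  "Phi M =
     (((X + Y + 1) powi M * (X + Y) + X - Y) / (2 * (X + Y + 1) powi (M + 1)),
      ((X + Y + 1) powi M * (X + Y) + Y - X) / (2 * (X + Y + 1) powi (M + 1)))"

end

theory Submission
  imports Defs "HOL-Computational_Algebra.Field_as_Ring"
begin

text \<open>
In the coordinates \<open>d = x - y\<close>, \<open>s = x + y\<close> both \<open>Phi (- N)\<close> and, after replacing \<open>d\<close> by \<open>s\<^sup>2/d\<close>,
\<open>Phi N\<close> become \<open>phi N\<close>. Every map in the list is therefore conjugate to \<open>phi N\<close> by a 1-BIR; such
conjugates are flows (\<open>conj_phi_flow\<close>), and the swap \<open>i0\<close> commutes with all ingredients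
(\<open>symmetric_form_is_flow\<close>).

Conversely, let \<open>\<phi> = l\<^sup>-\<^sup>1 \<circ> phi N \<circ> l\<close> be symmetric. Then \<open>j = l \<circ> i0 \<circ> l\<^sup>-\<^sup>1\<close> is a homogeneous
involution that commutes with \<open>phi N\<close>. For \<open>N \<ge> 2\<close> the only homogeneous maps doing so are \<open>(c x, y)\<close>
(\<open>centraliser_phi\<close>), by comparing degrees in \<open>y + 1\<close>; hence \<open>j = (- x, y)\<close>, which means that the
first component of \<open>l\<close> is antisymmetric and the second is symmetric. Their ratio \<open>g\<close> is a function of
\<open>x/y\<close> that has a rational inverse, so it is fractional linear (\<open>left_invertible_degree_le_1\<close>), and as
it changes sign under the swap, it is a constant times \<open>d/s\<close> or \<open>s/d\<close> (\<open>odd_ratio\<close>). With \<open>A\<close> the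
second component of \<open>l\<close> divided by \<open>s\<close>, these two cases say that \<open>l\<close> is, up to a map \<open>(c x, y)\<close> commuting with
\<open>phi N\<close>, the normalising coordinate change of \<open>Phi (- N)\<close> or of \<open>Phi N\<close> after the scaling by \<open>A\<close>.

The substitutions in these arguments are partial operations. They are made harmless by working
at points with algebraically independent coordinates (\<open>generic\<close>), where substitution is a field
homomorphism. The two maps of an inverse pair are such points, by \<open>generic_if_evals_XY\<close>, and
the points of \<open>\<real>(x,y,z)\<close> in the flow equation are obtained from them by \<open>generic_scale\<close>.
\<close>

section \<open>Substitution as a relation\<close>

text \<open>
A field extension of the reals, given by its embedding. The two that occur are \<open>\<real>(x,y)\<close> and
\<open>\<real>(x,y,z)\<close>.
\<close>

locale real_hom =
  fixes h :: "real \<Rightarrow> 'k::field"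
  assumes zero [simp]: "h 0 = 0" and one [simp]: "h 1 = 1"
    and add: "h (a + b) = h a + h b" and mult: "h (a * b) = h a * h b"

interpretation const2: real_hom const2
  by unfold_locales (simp_all add: const2_hom)

interpretation const3: real_hom const3
  by unfold_locales (simp_all add: const3_hom)

text \<open>
A relation that is compatible with addition, multiplication and the constants is compatible with
polynomials. The value at a point, the embedding of \<open>\<real>(x,y)\<close> into \<open>\<real>(x,y,z)\<close>, and the limit at
\<open>z = 0\<close> are all handled by choosing the relation; the first and the last are only partial maps,
which is why a relation appears instead of a homomorphism.
\<close>

lemma poly_map_poly_rel:
  assumes add: "\<And>a b c d. R a c \<Longrightarrow> R b d \<Longrightarrow> R (a + b) (c + d)"
    and mult: "\<And>a b c d. R a c \<Longrightarrow> R b d \<Longrightarrow> R (a * b) (c * d)"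
    and coeff: "\<And>r. R (f r) (g r)" and zero: "f 0 = 0" "g 0 = 0"
    and arg: "R t s"
  shows "R (poly (map_poly f p) t) (poly (map_poly g p) s)"
proof (induction p)
  case 0
  show ?case using coeff[of 0] zero by simp
next
  case (pCons a p)
  then show ?case by (simp add: map_poly_pCons zero add mult coeff arg)
qed

lemma eval_poly2_rel:
  assumes add: "\<And>a b c d. R a c \<Longrightarrow> R b d \<Longrightarrow> R (a + b) (c + d)"
    and mult: "\<And>a b c d. R a c \<Longrightarrow> R b d \<Longrightarrow> R (a * b) (c * d)"
    and const: "\<And>r. R (h r) (k r)" and zero: "h 0 = 0" "k 0 = 0"
    and arg: "R (fst p) (fst q)" "R (snd p) (snd q)"
  shows "R (eval_poly2 h P p) (eval_poly2 k P q)"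
  unfolding eval_poly2_def
  by (intro poly_map_poly_rel[where R = R] assms) simp_all

context real_hom
begin

lemma uminus: "h (- a) = - h a"
  using add[of a "- a"] by (simp add: eq_neg_iff_add_eq_0 add.commute)

lemma nonzero: "a \<noteq> 0 \<Longrightarrow> h a \<noteq> 0"
  using mult[of a "inverse a"] by auto

lemma inj: "h a = h b \<longleftrightarrow> a = b"
  using nonzero[of "a - b"] add[of a "- b"] by (auto simp: uminus)

lemma eval_poly2_simps:
  "eval_poly2 h 0 p = 0" "eval_poly2 h 1 p = 1"
  "eval_poly2 h (P + Q) p = eval_poly2 h P p + eval_poly2 h Q p"
  "eval_poly2 h (P * Q) p = eval_poly2 h P p * eval_poly2 h Q p"
  "eval_poly2 h (- P) p = - eval_poly2 h P p"
  "eval_poly2 h [:c:] p = poly (map_poly h c) (fst p)"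
  "eval_poly2 h [:0, 1:] p = snd p"
proof -
  show zero': "eval_poly2 h 0 p = 0" by (simp add: eval_poly2_def)
  show "eval_poly2 h 1 p = 1" by (simp add: eval_poly2_def map_poly_pCons)
  show plus: "eval_poly2 h (P + Q) p = eval_poly2 h P p + eval_poly2 h Q p" for P Q
    unfolding eval_poly2_def
    by (subst map_poly_add_hom) (simp_all add: map_poly_add_hom add)
  show "eval_poly2 h (P * Q) p = eval_poly2 h P p * eval_poly2 h Q p"
    by (rule eval_poly2_mult) (simp_all add: add mult)
  show "eval_poly2 h (- P) p = - eval_poly2 h P p"
    using plus[of P "- P"] zero' by (simp add: eq_neg_iff_add_eq_0 add.commute)
  show "eval_poly2 h [:c:] p = poly (map_poly h c) (fst p)"
    by (simp add: eval_poly2_def map_poly_pCons)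
  show "eval_poly2 h [:0, 1:] p = snd p"
    by (simp add: eval_poly2_def map_poly_pCons)
qed

end

text \<open>
As a relation, substitution is compatible with the field operations without any side condition
except the obvious one for division. This serves at points whose coordinates are algebraically
dependent, or not yet known to be independent, where substitution is only partially defined.
\<close>

definition evals :: "(real \<Rightarrow> 'k::field) \<Rightarrow> ratfun \<Rightarrow> 'k \<times> 'k \<Rightarrow> 'k \<Rightarrow> bool" where
  "evals h f p v \<longleftrightarrow>
     (\<exists>P Q. f = Fract P Q \<and> eval_poly2 h Q p \<noteq> 0 \<and> v = eval_poly2 h P p / eval_poly2 h Q p)"

lemma rf_defined_iff: "rf_defined h f p \<longleftrightarrow> (\<exists>v. evals h f p v)"
  by (auto simp: rf_defined_def evals_def)

context real_hom
begin

lemma evals_value: "evals h f p v \<Longrightarrow> rf_value h f p = v"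
  unfolding evals_def by (auto intro!: rf_value_Fract simp: add mult)

lemma evals_to_fract: "evals h (to_fract P) p (eval_poly2 h P p)"
  unfolding evals_def to_fract_def by (rule exI[of _ P], rule exI[of _ 1]) (simp add: eval_poly2_simps)

lemma evals_X: "evals h X p (fst p)"
  using evals_to_fract[of "[:[:0,1:]:]" p] by (simp add: X_def eval_poly2_simps map_poly_pCons)

lemma evals_Y: "evals h Y p (snd p)"
  using evals_to_fract[of "[:0,1:]" p] by (simp add: Y_def eval_poly2_simps)

lemma evals_const: "evals h (const2 r) p (h r)"
  using evals_to_fract[of "[:[:r:]:]" p] by (simp add: const2_def eval_poly2_simps map_poly_pCons)

lemma evals_0: "evals h 0 p 0" and evals_1: "evals h 1 p 1"
  using evals_const[of 0 p] evals_const[of 1 p] by (simp_all add: const2_hom)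

lemma evals_add:
  assumes "evals h f p v" "evals h g p w"
  shows "evals h (f + g) p (v + w)"
proof -
  obtain P Q where f: "f = Fract P Q" "eval_poly2 h Q p \<noteq> 0" "v = eval_poly2 h P p / eval_poly2 h Q p"
    using assms(1) by (auto simp: evals_def)
  obtain P' Q' where g: "g = Fract P' Q'" "eval_poly2 h Q' p \<noteq> 0" "w = eval_poly2 h P' p / eval_poly2 h Q' p"
    using assms(2) by (auto simp: evals_def)
  have "Q \<noteq> 0" "Q' \<noteq> 0" using f(2) g(2) by (auto simp: eval_poly2_simps)
  then have "f + g = Fract (P * Q' + P' * Q) (Q * Q')" by (simp add: f(1) g(1))
  moreover have "v + w = eval_poly2 h (P * Q' + P' * Q) p / eval_poly2 h (Q * Q') p"
    using f(2) g(2) unfolding f(3) g(3) by (simp add: eval_poly2_simps add_frac_eq)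
  moreover have "eval_poly2 h (Q * Q') p \<noteq> 0" using f g by (simp add: eval_poly2_simps)
  ultimately show ?thesis unfolding evals_def by blast
qed

lemma evals_mult:
  assumes "evals h f p v" "evals h g p w"
  shows "evals h (f * g) p (v * w)"
proof -
  obtain P Q where f: "f = Fract P Q" "eval_poly2 h Q p \<noteq> 0" "v = eval_poly2 h P p / eval_poly2 h Q p"
    using assms(1) by (auto simp: evals_def)
  obtain P' Q' where g: "g = Fract P' Q'" "eval_poly2 h Q' p \<noteq> 0" "w = eval_poly2 h P' p / eval_poly2 h Q' p"
    using assms(2) by (auto simp: evals_def)
  have "f * g = Fract (P * P') (Q * Q')" by (simp add: f(1) g(1))
  moreover have "v * w = eval_poly2 h (P * P') p / eval_poly2 h (Q * Q') p"
    using f g by (simp add: eval_poly2_simps)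
  moreover have "eval_poly2 h (Q * Q') p \<noteq> 0" using f g by (simp add: eval_poly2_simps)
  ultimately show ?thesis unfolding evals_def by blast
qed

lemma evals_inverse:
  assumes "evals h f p v" "v \<noteq> 0"
  shows "evals h (inverse f) p (inverse v)"
proof -
  obtain P Q where f: "f = Fract P Q" "eval_poly2 h Q p \<noteq> 0" "v = eval_poly2 h P p / eval_poly2 h Q p"
    using assms(1) by (auto simp: evals_def)
  have "inverse f = Fract Q P" "eval_poly2 h P p \<noteq> 0" "inverse v = eval_poly2 h Q p / eval_poly2 h P p"
    using f assms(2) by simp_all
  then show ?thesis unfolding evals_def by blast
qed

lemma evals_uminus: "evals h f p v \<Longrightarrow> evals h (- f) p (- v)"
  using evals_mult[OF evals_const[of "- 1" p]] 
  by (simp add: const2.uminus uminus const2_hom)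

lemma evals_diff: "evals h f p v \<Longrightarrow> evals h g p w \<Longrightarrow> evals h (f - g) p (v - w)"
  using evals_add[OF _ evals_uminus] by fastforce

lemma evals_divide:
  "evals h f p v \<Longrightarrow> evals h g p w \<Longrightarrow> w \<noteq> 0 \<Longrightarrow> evals h (f / g) p (v / w)"
  unfolding divide_inverse by (intro evals_mult evals_inverse)

lemma evals_power: "evals h f p v \<Longrightarrow> evals h (f ^ n) p (v ^ n)"
  by (induction n) (simp_all add: evals_1 evals_mult)

lemma evals_power_int: "evals h f p v \<Longrightarrow> v \<noteq> 0 \<Longrightarrow> evals h (f powi n) p (v powi n)"
  by (auto simp: power_int_def evals_power evals_inverse)

lemma evals_poly:
  "evals h f p v \<Longrightarrow> evals h (poly (map_poly const2 q) f) p (poly (map_poly h q) v)"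
  by (rule poly_map_poly_rel[where R = "\<lambda>f v. evals h f p v"])
    (simp_all add: evals_add evals_mult evals_const)

lemma evals_eval_poly2:
  "evals h (fst f) p (fst v) \<Longrightarrow> evals h (snd f) p (snd v) \<Longrightarrow>
     evals h (eval_poly2 const2 P f) p (eval_poly2 h P v)"
  by (rule eval_poly2_rel[where R = "\<lambda>f v. evals h f p v"])
    (simp_all add: evals_add evals_mult evals_const)

end

lemmas (in real_hom) evals_intros =
  evals_X evals_Y evals_const evals_0 evals_1 evals_add evals_mult evals_uminus evals_diff
  evals_divide evals_power evals_power_int evals_poly

section \<open>Generic points\<close>

text \<open>
The coordinates of a generic point are algebraically independent over \<open>\<real>\<close>. Substituting such
a point is then a field homomorphism on all of \<open>\<real>(x,y)\<close>, so no denominator has to be watched.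
\<close>

definition generic :: "(real \<Rightarrow> 'k::field) \<Rightarrow> 'k \<times> 'k \<Rightarrow> bool" where
  "generic h p \<longleftrightarrow> (\<forall>P. eval_poly2 h P p = 0 \<longrightarrow> P = 0)"

context real_hom
begin

lemma generic_evals: "generic h p \<Longrightarrow> evals h f p (rf_value h f p)"
proof (cases f)
  case (Fract P Q)
  assume "generic h p"
  then have "eval_poly2 h Q p \<noteq> 0" using Fract by (auto simp: generic_def)
  then have "evals h f p (eval_poly2 h P p / eval_poly2 h Q p)"
    using Fract unfolding evals_def by blast
  with evals_value[OF this] show ?thesis by simp
qed

lemma generic_map_defined: "generic h p \<Longrightarrow> map_defined h \<phi> p"
  unfolding map_defined_def rf_defined_iff by (blast intro: generic_evals)

lemma rf_value_to_fract: "rf_value h (to_fract P) p = eval_poly2 h P p"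
  by (rule evals_value[OF evals_to_fract])

lemma rf_value_eq_0_iff: "generic h p \<Longrightarrow> rf_value h f p = 0 \<longleftrightarrow> f = 0"
proof
  assume g: "generic h p" and "rf_value h f p = 0"
  with generic_evals[OF g, of f] obtain P Q where "f = Fract P Q" "eval_poly2 h P p = 0"
    by (auto simp: evals_def)
  with g have "P = 0" by (simp add: generic_def)
  with \<open>f = Fract P Q\<close> show "f = 0" by (simp add: fract_collapse)
next
  show "f = 0 \<Longrightarrow> rf_value h f p = 0" using evals_value[OF evals_0] by simp
qed

lemma rf_value_simps:
  "rf_value h X p = fst p" "rf_value h Y p = snd p" "rf_value h (const2 r) p = h r"
  "rf_value h 0 p = 0" "rf_value h 1 p = 1"
  by (intro evals_value evals_intros)+

lemma rf_value_hom:
  assumes "generic h p"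
  shows "rf_value h (f + g) p = rf_value h f p + rf_value h g p"
    "rf_value h (f * g) p = rf_value h f p * rf_value h g p"
    "rf_value h (f - g) p = rf_value h f p - rf_value h g p"
    "rf_value h (- f) p = - rf_value h f p"
    "rf_value h (f / g) p = rf_value h f p / rf_value h g p"
    "rf_value h (f powi n) p = rf_value h f p powi n"
    "rf_value h (f ^ k) p = rf_value h f p ^ k"
    "rf_value h (poly (map_poly const2 q) f) p = poly (map_poly h q) (rf_value h f p)"
proof -
  note [intro] = generic_evals[OF assms]
  show "rf_value h (f / g) p = rf_value h f p / rf_value h g p"
  proof (cases "g = 0")
    case False
    then show ?thesis using rf_value_eq_0_iff[OF assms] by (intro evals_value evals_intros) auto
  qed (simp add: rf_value_simps)
  show "rf_value h (f powi n) p = rf_value h f p powi n"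
  proof (cases "f = 0")
    case False
    then show ?thesis using rf_value_eq_0_iff[OF assms] by (intro evals_value evals_intros) auto
  qed (simp add: rf_value_simps power_int_def power_0_left)
qed (intro evals_value evals_intros generic_evals[OF assms])+

lemma rf_value_numeral:
  assumes "generic h p"
  shows "rf_value h (numeral n) p = numeral n"
  by (induction n) (simp_all only: numeral.simps rf_value_simps rf_value_hom[OF assms])

lemma generic_poly_eq_0:
  assumes "generic h p" "poly (map_poly h q) (fst p) = 0"
  shows "q = 0"
  using assms by (metis eval_poly2_simps(6) generic_def pCons_eq_0_iff)

lemma generic_nonzero:
  assumes "generic h p"
  shows "fst p \<noteq> 0" "snd p \<noteq> 0"
  using generic_poly_eq_0[OF assms, of "[:0,1:]"] assms 
    eval_poly2_simps(7)[of p]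
  by (auto simp: map_poly_pCons generic_def)

end

section \<open>Composition of generic maps\<close>

context real_hom
begin

lemma rf_value_Fract_generic:
  "generic h p \<Longrightarrow> rf_value h (Fract P Q) p = eval_poly2 h P p / eval_poly2 h Q p"
  by (simp add: Fract_conv_to_fract rf_value_hom rf_value_to_fract)

lemma eval_poly2_map_value:
  assumes "generic h p"
  shows "eval_poly2 h P (map_value h \<psi> p) = rf_value h (eval_poly2 const2 P \<psi>) p"
proof (rule sym, rule evals_value, rule evals_eval_poly2)
qed (simp_all add: map_value_def generic_evals assms)

lemma generic_map_value:
  assumes "generic const2 \<psi>" "generic h p"
  shows "generic h (map_value h \<psi> p)"
  using assms by (auto simp: generic_def[of h "map_value h \<psi> p"] eval_poly2_map_value
      rf_value_eq_0_iff generic_def[of const2])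

lemma rf_value_comp:
  assumes "generic const2 \<psi>" "generic h p"
  shows "rf_value h (rf_value const2 f \<psi>) p = rf_value h f (map_value h \<psi> p)"
proof (cases f)
  case (Fract P Q)
  then show ?thesis
    using assms by (simp add: const2.rf_value_Fract_generic rf_value_Fract_generic
        generic_map_value eval_poly2_map_value rf_value_hom)
qed

lemma map_value_rcomp:
  assumes "generic const2 \<psi>" "generic h p"
  shows "map_value h (\<phi> \<circ>\<^sub>R \<psi>) p = map_value h \<phi> (map_value h \<psi> p)"
  using rf_value_comp[OF assms] by (simp add: rcomp_def map_value_def)

end

lemma eval_poly2_XY: "eval_poly2 const2 P (X, Y) = to_fract P"
proof -
  have inner: "poly (map_poly const2 c) X = to_fract [:c:]" for c
  proof (induction c)
    case (pCons a c)
    have "[:pCons a c:] = [:[:a:]:] + [:[:0, 1:]:] * [:c:]" by simp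
    then have "to_fract [:pCons a c:] = const2 a + X * to_fract [:c:]"
      unfolding const2_def X_def by (metis to_fract_add to_fract_mult)
    then show ?case by (simp add: map_poly_pCons pCons)
  qed simp
  show ?thesis
  proof (induction P)
    case (pCons c P)
    have "pCons c P = [:c:] + [:0, 1:] * P" by simp
    then have "to_fract (pCons c P) = to_fract [:c:] + Y * to_fract P"
      unfolding Y_def by (metis to_fract_add to_fract_mult)
    then show ?case using pCons by (simp add: eval_poly2_def map_poly_pCons inner)
  qed (simp add: const2.eval_poly2_simps)
qed

lemma generic_XY: "generic const2 (X, Y)"
  by (simp add: generic_def eval_poly2_XY)

lemma rf_value_XY [simp]: "rf_value const2 f (X, Y) = f"
  by (cases f) (simp add: const2.rf_value_Fract_generic generic_XY eval_poly2_XY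
      flip: Fract_conv_to_fract)

lemma rcomp_XY_right [simp]: "\<phi> \<circ>\<^sub>R (X, Y) = \<phi>"
  by (simp add: rcomp_def map_value_def)

lemma rcomp_XY_left [simp]: "(X, Y) \<circ>\<^sub>R \<phi> = \<phi>"
  by (simp add: rcomp_def map_value_def const2.rf_value_simps)

lemma generic_rcomp: "generic const2 \<phi> \<Longrightarrow> generic const2 \<psi> \<Longrightarrow> generic const2 (\<phi> \<circ>\<^sub>R \<psi>)"
  unfolding rcomp_def by (rule const2.generic_map_value)

lemma rcomp_assoc:
  "generic const2 \<psi> \<Longrightarrow> generic const2 \<chi> \<Longrightarrow> \<phi> \<circ>\<^sub>R \<psi> \<circ>\<^sub>R \<chi> = \<phi> \<circ>\<^sub>R (\<psi> \<circ>\<^sub>R \<chi>)"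
  by (simp add: rcomp_def const2.map_value_rcomp[unfolded rcomp_def])

text \<open>
If \<open>l\<close> can be substituted into \<open>m\<close> and the result is the identity, a polynomial relation
between the components of \<open>m\<close> would become the same relation between \<open>X\<close> and \<open>Y\<close>. This is why
both maps of an inverse pair are generic.
\<close>

lemma generic_if_evals_XY:
  assumes "evals const2 (fst m) l X" "evals const2 (snd m) l Y"
  shows "generic const2 m"
  unfolding generic_def
proof (intro allI impI)
  fix P assume "eval_poly2 const2 P m = 0"
  then have "evals const2 0 l (eval_poly2 const2 P (X, Y))"
    using const2.evals_eval_poly2[of m l "(X, Y)" P] assms by simp
  from const2.evals_value[OF this] show "P = 0"
    by (simp add: const2.rf_value_simps eval_poly2_XY)
qed

lemma inverse_mapsI:
  assumes "evals const2 (fst l) m X" "evals const2 (snd l) m Y"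
    and "evals const2 (fst m) l X" "evals const2 (snd m) l Y"
  shows "inverse_maps l m"
  using assms unfolding inverse_maps_def map_defined_def rf_defined_iff rcomp_def map_value_def
  by (auto simp: const2.evals_value)

lemma inverse_maps_sym: "inverse_maps l m \<Longrightarrow> inverse_maps m l"
  by (auto simp: inverse_maps_def)

lemma inverse_maps_rcomp_eq: "inverse_maps l m \<Longrightarrow> l \<circ>\<^sub>R m = (X, Y)"
  by (auto simp: inverse_maps_def)

lemma inverse_maps_generic:
  assumes "inverse_maps l m"
  shows "generic const2 l" "generic const2 m"
  using assms unfolding inverse_maps_def map_defined_def rf_defined_iff rcomp_def map_value_def
  by (auto intro: generic_if_evals_XY[of m l] generic_if_evals_XY[of l m] simp: const2.evals_value)

lemma inverse_maps_iff_generic: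
  "inverse_maps l m \<longleftrightarrow>
     generic const2 l \<and> generic const2 m \<and> l \<circ>\<^sub>R m = (X, Y) \<and> m \<circ>\<^sub>R l = (X, Y)"
  using inverse_maps_generic const2.generic_map_defined unfolding inverse_maps_def by blast

lemma inverse_maps_rcomp:
  assumes "inverse_maps l m" "inverse_maps l' m'"
  shows "inverse_maps (l \<circ>\<^sub>R l') (m' \<circ>\<^sub>R m)"
proof -
  note a = assms[unfolded inverse_maps_iff_generic]
  have "l \<circ>\<^sub>R l' \<circ>\<^sub>R (m' \<circ>\<^sub>R m) = l \<circ>\<^sub>R (l' \<circ>\<^sub>R m' \<circ>\<^sub>R m)"
    using a rcomp_assoc[of l' "m' \<circ>\<^sub>R m" l] rcomp_assoc[of m' m l'] generic_rcomp by presburger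
  moreover have "m' \<circ>\<^sub>R m \<circ>\<^sub>R (l \<circ>\<^sub>R l') = m' \<circ>\<^sub>R (m \<circ>\<^sub>R l \<circ>\<^sub>R l')"
    using a rcomp_assoc[of m "l \<circ>\<^sub>R l'" m'] rcomp_assoc[of l l' m] generic_rcomp by presburger
  ultimately show ?thesis
    using a by (simp add: inverse_maps_iff_generic generic_rcomp)
qed

lemma rinv_eq:
  assumes "inverse_maps l m"
  shows "rinv l = m"
  unfolding rinv_def
proof (rule the_equality)
  show "inverse_maps l m" by fact
  fix m' assume "inverse_maps l m'"
  then have a: "generic const2 l" "generic const2 m" "l \<circ>\<^sub>R m = (X, Y)" "m' \<circ>\<^sub>R l = (X, Y)"
    using assms unfolding inverse_maps_iff_generic by blast+
  show "m' = m" using rcomp_assoc[OF a(1,2), of m'] unfolding a(3,4) by simp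
qed

section \<open>Homogeneous rational functions\<close>

lemma emb_simps [simp]:
  "emb 0 = 0" "emb 1 = 1" "emb (f + g) = emb f + emb g" "emb (f * g) = emb f * emb g"
  "emb f = emb g \<longleftrightarrow> f = g" "emb f = 0 \<longleftrightarrow> f = 0"
  by (simp_all add: emb_def flip: to_fract_add to_fract_mult one_pCons)

lemma emb_divide [simp]: "emb (f / g) = emb f / emb g"
proof (cases "g = 0")
  case False
  then have "emb f = emb (f / g) * emb g" by (simp flip: emb_simps)
  then show ?thesis using False by (simp add: divide_simps)
qed simp

abbreviation emb_map :: "ratmap \<Rightarrow> ratfun3 \<times> ratfun3" where
  "emb_map w \<equiv> (emb (fst w), emb (snd w))"

lemma eval_poly2_emb_map: "eval_poly2 const3 P (emb_map w) = emb (eval_poly2 const2 P w)"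
  by (rule eval_poly2_rel[where R = "\<lambda>a b. a = emb b"]) (simp_all add: const3_def const2_hom)

lemma rf_value_emb_map:
  assumes "generic const2 w"
  shows "rf_value const3 f (emb_map w) = emb (rf_value const2 f w)"
proof -
  have "generic const3 (emb_map w)"
    using assms by (simp add: generic_def eval_poly2_emb_map)
  then show ?thesis
    using assms by (cases f) (simp add: const2.rf_value_Fract_generic
        const3.rf_value_Fract_generic eval_poly2_emb_map)
qed

lemma map_value_emb_map:
  "generic const2 w \<Longrightarrow> map_value const3 \<phi> (emb_map w) = emb_map (\<phi> \<circ>\<^sub>R w)"
  by (simp add: map_value_def rcomp_def rf_value_emb_map)

text \<open>
  Specialising \<open>z\<close> to a value where the factor \<open>c\<close> becomes \<open>1\<close> turns a polynomial relation
  between the components of \<open>c \<cdot> w\<close> into one between the components of \<open>w\<close>.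
\<close>

lemma generic_scale:
  assumes "generic const2 w" "poly c a = 1"
  shows "generic const3 (scale (to_fract c) (emb_map w))"
  unfolding generic_def
proof (intro allI impI)
  fix P assume 0: "eval_poly2 const3 P (scale (to_fract c) (emb_map w)) = 0"
  let ?R = "\<lambda>f v. \<exists>H. f = to_fract H \<and> poly H a = v"
  have "?R (eval_poly2 const3 P (scale (to_fract c) (emb_map w))) (eval_poly2 const2 P w)"
  proof (rule eval_poly2_rel[where R = ?R])
    show "?R (a + b) (c + d)" if "?R a c" "?R b d" for a b c d
      using that by (metis poly_add to_fract_add)
    show "?R (a * b) (c * d)" if "?R a c" "?R b d" for a b c d
      using that by (metis poly_mult to_fract_mult)
    show "?R (const3 r) (const2 r)" for r
      by (rule exI[of _ "[:const2 r:]"]) (simp add: const3_def emb_def)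
    show "?R (fst (scale (to_fract c) (emb_map w))) (fst w)"
      by (rule exI[of _ "c * [:fst w:]"]) (simp add: scale_def emb_def assms flip: to_fract_mult)
    show "?R (snd (scale (to_fract c) (emb_map w))) (snd w)"
      by (rule exI[of _ "c * [:snd w:]"]) (simp add: scale_def emb_def assms flip: to_fract_mult)
  qed (simp_all add: const2_hom const3_hom)
  then show "P = 0" using 0 assms(1) by (auto simp: generic_def)
qed

lemma generic_emb_map: "generic const2 w \<Longrightarrow> generic const3 (emb_map w)"
  using generic_scale[of w 1 0] by (simp add: scale_def)

lemma generic_scale_Z: "generic const2 w \<Longrightarrow> generic const3 (scale Z (emb_map w))"
  unfolding Z_def by (rule generic_scale[where a = 1]) simp_all

lemma one_minus_Z: "1 - Z = to_fract [:1, - 1:]"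
proof -
  have "[:1, - 1:] = 1 - [:0, 1 :: ratfun:]" by (simp add: one_pCons[where ?'a = ratfun])
  then show ?thesis by (simp only: Z_def to_fract_diff to_fract_1)
qed

lemma generic_scale_1_minus_Z: "generic const2 w \<Longrightarrow> generic const3 (scale (1 - Z) (emb_map w))"
  unfolding one_minus_Z by (rule generic_scale[where a = 0]) simp_all

lemma xz_eq_scale: "(emb X * Z, emb Y * Z) = scale Z (emb_map (X, Y))"
  by (simp add: scale_def mult.commute)

lemma generic_xz: "generic const3 (emb X * Z, emb Y * Z)"
  unfolding xz_eq_scale by (rule generic_scale_Z[OF generic_XY])

lemma Z_nonzero [simp]: "Z \<noteq> 0" "Z \<noteq> 1"
proof -
  show "Z \<noteq> 0" by (simp add: Z_def)
  have "1 - Z \<noteq> 0" unfolding one_minus_Z by simp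
  then show "Z \<noteq> 1" by simp
qed

lemma homogeneous_X: "homogeneous 1 X" and homogeneous_Y: "homogeneous 1 Y"
  by (simp_all add: homogeneous_def const3.rf_value_simps mult.commute)

lemma homogeneous_mult:
  "homogeneous d f \<Longrightarrow> homogeneous e g \<Longrightarrow> homogeneous (d + e) (f * g)"
  by (simp add: homogeneous_def const3.rf_value_hom[OF generic_xz] power_int_add)

lemma homogeneous_divide:
  "homogeneous d f \<Longrightarrow> homogeneous e g \<Longrightarrow> homogeneous (d - e) (f / g)"
  by (simp add: homogeneous_def const3.rf_value_hom[OF generic_xz] power_int_diff)

lemma homogeneous_add: "homogeneous d f \<Longrightarrow> homogeneous d g \<Longrightarrow> homogeneous d (f + g)"
  by (simp add: homogeneous_def const3.rf_value_hom[OF generic_xz] distrib_left)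

lemma emb_diff [simp]: "emb (f - g) = emb f - emb g"
  using emb_simps(3)[of "f - g" g] by (simp add: algebra_simps)

lemma homogeneous_diff: "homogeneous d f \<Longrightarrow> homogeneous d g \<Longrightarrow> homogeneous d (f - g)"
  by (simp add: homogeneous_def const3.rf_value_hom[OF generic_xz] right_diff_distrib)

lemma (in real_hom) poly_map_poly_simps:
  "poly (map_poly h (p + q)) t = poly (map_poly h p) t + poly (map_poly h q) t"
  "poly (map_poly h (p * q)) t = poly (map_poly h p) t * poly (map_poly h q) t"
  "poly (map_poly h (sum f A)) t = (\<Sum>i\<in>A. poly (map_poly h (f i)) t)"
proof -
  show plus: "poly (map_poly h (p + q)) t = poly (map_poly h p) t + poly (map_poly h q) t" for p q
    by (simp add: map_poly_add_hom add)
  show "poly (map_poly h (p * q)) t = poly (map_poly h p) t * poly (map_poly h q) t"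
    by (simp add: map_poly_mult_hom add mult)
  show "poly (map_poly h (sum f A)) t = (\<Sum>i\<in>A. poly (map_poly h (f i)) t)"
    by (induction A rule: infinite_finite_induct) (simp_all add: plus)
qed

text \<open>
  Substituting \<open>(xz, yz)\<close> into a polynomial gives a polynomial in \<open>z\<close> whose \<open>n\<close>-th coefficient
  is the homogeneous component of degree \<open>n\<close>, that is \<open>y\<^sup>n\<close> times a polynomial in \<open>x/y\<close>.
\<close>

lemma eval_poly2_xz:
  "\<exists>H. eval_poly2 const3 P (emb X * Z, emb Y * Z) = to_fract H \<and>
       (\<forall>n. \<exists>u. coeff H n = Y ^ n * poly (map_poly const2 u) (X / Y))"
  (is "?R (eval_poly2 _ _ _)")
proof (rule eval_poly2_rel[where R = "\<lambda>f (_::real). ?R f" and k = id and q = "(0,0)"])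
  fix f g assume "?R f" "?R g"
  then obtain H K u v where H: "f = to_fract H" "\<And>n. coeff H n = Y ^ n * poly (map_poly const2 (u n)) (X / Y)"
    and K: "g = to_fract K" "\<And>n. coeff K n = Y ^ n * poly (map_poly const2 (v n)) (X / Y)"
    by metis
  show "?R (f + g)"
    by (rule exI[of _ "H + K"], simp add: H K, intro allI, rule_tac x = "u n + v n" in exI)
      (simp add: const2.poly_map_poly_simps algebra_simps)
  have "coeff (H * K) n = Y ^ n * poly (map_poly const2 (\<Sum>i\<le>n. u i * v (n - i))) (X / Y)" for n
  proof -
    have "coeff H i * coeff K (n - i) = Y ^ n * poly (map_poly const2 (u i * v (n - i))) (X / Y)"
      if "i \<le> n" for i
    proof -
      have "Y ^ n = Y ^ i * Y ^ (n - i)" using that by (simp flip: power_add)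
      then show ?thesis by (simp add: H K const2.poly_map_poly_simps)
    qed
    then show ?thesis
      by (simp add: coeff_mult const2.poly_map_poly_simps(3) sum_distrib_left)
  qed
  then show "?R (f * g)"
    by (intro exI[of _ "H * K"] conjI allI) (auto simp: H(1) K(1))
next
  have const: "\<exists>u. coeff [:const2 r:] n = Y ^ n * poly (map_poly const2 u) (X / Y)" for r n
    by (rule exI[of _ "if n = 0 then [:r:] else 0"]) (simp add: coeff_pCons map_poly_pCons split: nat.splits)
  show "?R (const3 r)" for r
    by (rule exI[of _ "[:const2 r:]"]) (use const in \<open>auto simp: const3_def emb_def\<close>)
  have "Y \<noteq> 0" using const2.generic_nonzero[OF generic_XY] by simp
  then have X: "\<exists>u. coeff [:0, X:] n = Y ^ n * poly (map_poly const2 u) (X / Y)" for n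
    by (intro exI[of _ "if n = 1 then [:0, 1:] else 0"]) 
      (auto simp: coeff_pCons map_poly_pCons split: nat.splits)
  show "?R (fst (emb X * Z, emb Y * Z))"
    by (rule exI[of _ "[:0, X:]"]) (use X in \<open>auto simp: emb_def Z_def simp flip: to_fract_mult\<close>)
  have Y: "\<exists>u. coeff [:0, Y:] n = Y ^ n * poly (map_poly const2 u) (X / Y)" for n
    by (intro exI[of _ "if n = 1 then 1 else 0"]) 
      (auto simp: coeff_pCons map_poly_pCons split: nat.splits)
  show "?R (snd (emb X * Z, emb Y * Z))"
    by (rule exI[of _ "[:0, Y:]"]) (use Y in \<open>auto simp: emb_def Z_def simp flip: to_fract_mult\<close>)
qed (simp_all add: const3_hom)

text \<open>
The change of coordinates to \<open>(x/y, y + 1)\<close> is invertible. In these coordinates \<open>phi N\<close> acts most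
simply: it multiplies the first one by the \<open>N\<close>-th power of the second.
\<close>

lemma generic_ratio_shift: "generic const2 (X / Y, Y + 1)"
proof (rule generic_if_evals_XY[where l = "(X * (Y - 1), Y - 1)"])
  have "Y - 1 \<noteq> 0"
    using const2.generic_nonzero generic_XY by (simp add: Y_def flip: to_fract_1 to_fract_diff) (simp add: one_pCons)
  then show "evals const2 (fst (X / Y, Y + 1)) (X * (Y - 1), Y - 1) X"
    using const2.evals_divide[OF const2.evals_X[of "(X * (Y - 1), Y - 1)"] const2.evals_Y] by simp
  show "evals const2 (snd (X / Y, Y + 1)) (X * (Y - 1), Y - 1) Y"
    using const2.evals_add[OF const2.evals_Y[of "(X * (Y - 1), Y - 1)"] const2.evals_1] by simp
qed

lemma poly_ratio_eq_0_iff: "poly (map_poly const2 u) (X / Y) = 0 \<longleftrightarrow> u = 0"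
  using const2.generic_poly_eq_0[OF generic_ratio_shift, of u] by auto

text \<open>
Write \<open>f = P/Q\<close>. Homogeneity says that \<open>P(xz, yz)\<close> and \<open>f \<cdot> Q(xz, yz)\<close> agree as polynomials in
\<open>z\<close>, so \<open>f\<close> is the quotient of two homogeneous components of equal degree \<open>n\<close>, where the factors
\<open>y\<^sup>n\<close> cancel.
\<close>

lemma homogeneous_0_ratio:
  assumes "homogeneous 0 f"
  obtains u v where "v \<noteq> 0" "coprime u v"
    "f = poly (map_poly const2 u) (X / Y) / poly (map_poly const2 v) (X / Y)"
proof (cases f)
  case (Fract P Q)
  obtain H u where H: "eval_poly2 const3 P (emb X * Z, emb Y * Z) = to_fract H"
    "\<And>n. coeff H n = Y ^ n * poly (map_poly const2 (u n)) (X / Y)"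
    using eval_poly2_xz[of P] by metis
  obtain K v where K: "eval_poly2 const3 Q (emb X * Z, emb Y * Z) = to_fract K"
    "\<And>n. coeff K n = Y ^ n * poly (map_poly const2 (v n)) (X / Y)"
    using eval_poly2_xz[of Q] by metis
  have K0: "K \<noteq> 0"
    using K(1) Fract(2) generic_xz by (auto simp: generic_def)
  have "to_fract H = emb f * to_fract K"
    using assms K0 unfolding homogeneous_def Fract(1)
      const3.rf_value_Fract_generic[OF generic_xz] H(1) K(1) by (simp add: divide_simps)
  then have HK: "H = smult f K" by (simp add: emb_def flip: to_fract_mult)
  obtain n where n: "coeff K n \<noteq> 0" using K0 by (metis leading_coeff_0_iff)
  then have "f = coeff H n / coeff K n" by (simp add: HK)
  also have "\<dots> = poly (map_poly const2 (u n)) (X / Y) / poly (map_poly const2 (v n)) (X / Y)"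
    unfolding H K by (rule mult_divide_mult_cancel_left) (use n in \<open>simp add: K\<close>)
  finally have f: "f = poly (map_poly const2 (u n)) (X / Y) / poly (map_poly const2 (v n)) (X / Y)" .
  have v: "v n \<noteq> 0" using n K(2)[of n] by auto
  then obtain u' v' where uv: "u n = u' * gcd (u n) (v n)" "v n = v' * gcd (u n) (v n)" "coprime u' v'"
    using gcd_coprime_exists[of "u n" "v n"] by auto
  have "v' \<noteq> 0" "gcd (u n) (v n) \<noteq> 0" using v uv(2) by auto
  then show ?thesis
    using that[OF _ uv(3)] f by (subst (asm) uv(1), subst (asm) uv(2))
      (simp add: const2.poly_map_poly_simps poly_ratio_eq_0_iff)
qed

lemma homogeneous_ratio:
  assumes "homogeneous 1 f"
  obtains u v where "v \<noteq> 0"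
    "f = Y * (poly (map_poly const2 u) (X / Y) / poly (map_poly const2 v) (X / Y))"
proof -
  have "homogeneous 0 (f / Y)" using homogeneous_divide[OF assms homogeneous_Y] by simp
  then obtain u v where uv: "v \<noteq> 0"
    "f / Y = poly (map_poly const2 u) (X / Y) / poly (map_poly const2 v) (X / Y)"
    by (rule homogeneous_0_ratio)
  have "Y \<noteq> 0" using const2.generic_nonzero[OF generic_XY] by simp
  then have "f = Y * (f / Y)" by simp
  then show ?thesis using that uv by metis
qed

context real_hom
begin

text \<open>
The point \<open>c \<cdot> w\<close> need not be generic when \<open>w\<close> is, for example if \<open>c\<close> cancels a coordinate of
\<open>w\<close>; but the ratio of its coordinates is that of \<open>w\<close>, and homogeneous functions see little else.
\<close>

lemma evals_ratio:
  assumes "generic h w" "c \<noteq> 0" "v \<noteq> 0"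
  shows "evals h (poly (map_poly const2 u) (X / Y) / poly (map_poly const2 v) (X / Y))
     (c * fst w, c * snd w) (rf_value h (poly (map_poly const2 u) (X / Y) / poly (map_poly const2 v) (X / Y)) w)"
proof -
  note nz = generic_nonzero[OF assms(1)]
  have "evals h (X / Y) (c * fst w, c * snd w) (c * fst w / (c * snd w))"
    using evals_divide[OF evals_X[of "(c * fst w, c * snd w)"] evals_Y] assms(2) nz
    by (simp only: fst_conv snd_conv mult_eq_0_iff simp_thms)
  then have T: "evals h (X / Y) (c * fst w, c * snd w) (rf_value h (X / Y) w)"
    using assms(2) by (simp add: rf_value_hom(5)[OF assms(1)] rf_value_simps)
  have "rf_value h (poly (map_poly const2 v) (X / Y)) w \<noteq> 0"
    using assms by (simp add: rf_value_eq_0_iff poly_ratio_eq_0_iff)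
  then show ?thesis
    unfolding rf_value_hom(5)[OF assms(1), of "poly _ _"] rf_value_hom(8)[OF assms(1)]
    by (intro evals_divide evals_poly T)
qed

lemma evals_scale_0:
  assumes "homogeneous 0 f" "generic h w" "c \<noteq> 0"
  shows "evals h f (c * fst w, c * snd w) (rf_value h f w)"
  using homogeneous_0_ratio[OF assms(1)] evals_ratio[OF assms(2,3)] by metis

lemma evals_scale_1:
  assumes "homogeneous 1 f" "generic h w" "c \<noteq> 0"
  shows "evals h f (c * fst w, c * snd w) (c * rf_value h f w)"
proof -
  have "homogeneous 0 (f / Y)" using homogeneous_divide[OF assms(1) homogeneous_Y] by simp
  from evals_mult[OF evals_Y evals_scale_0[OF this assms(2,3)]]
  have "evals h (Y * (f / Y)) (c * fst w, c * snd w) (c * snd w * rf_value h (f / Y) w)"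
    by (simp only: snd_conv)
  moreover have "Y \<noteq> 0" using const2.generic_nonzero[OF generic_XY] by simp
  ultimately show ?thesis
    using generic_nonzero[OF assms(2)] by (simp add: rf_value_hom[OF assms(2)] rf_value_simps)
qed

lemma map_value_scale:
  assumes "homogeneous 1 (fst l)" "homogeneous 1 (snd l)" "generic h w" "c \<noteq> 0"
  shows "map_value h l (c * fst w, c * snd w) =
    (c * fst (map_value h l w), c * snd (map_value h l w))"
  using evals_value[OF evals_scale_1] assms by (simp add: map_value_def)

end

lemma map_value_scale3:
  assumes "homogeneous 1 (fst l)" "homogeneous 1 (snd l)" "generic const3 w" "c \<noteq> 0"
  shows "map_value const3 l (scale c w) = scale c (map_value const3 l w)"
  using const3.map_value_scale[OF assms] by (simp add: scale_def)

text \<open>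
Apply \<open>m\<close> to \<open>l(z \<cdot> m) = z \<cdot> l(m) = (xz, yz)\<close>.
\<close>

lemma homogeneous_inverse:
  assumes "inverse_maps l m" "homogeneous 1 (fst l)" "homogeneous 1 (snd l)"
  shows "homogeneous 1 (fst m) \<and> homogeneous 1 (snd m)"
proof -
  have g: "generic const2 l" "generic const2 m" using assms inverse_maps_generic by auto
  have "map_value const3 l (scale Z (emb_map m)) = scale Z (emb_map (X, Y))"
    using assms g by (simp add: map_value_scale3 generic_emb_map map_value_emb_map inverse_maps_rcomp_eq)
  then have "map_value const3 m (scale Z (emb_map (X, Y))) =
      map_value const3 (m \<circ>\<^sub>R l) (scale Z (emb_map m))"
    using g by (simp add: const3.map_value_rcomp generic_scale_Z)
  also have "m \<circ>\<^sub>R l = (X, Y)" using assms inverse_maps_sym inverse_maps_rcomp_eq by blast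
  also have "map_value const3 (X, Y) (scale Z (emb_map m)) = scale Z (emb_map m)"
    by (simp add: map_value_def const3.rf_value_simps)
  finally show ?thesis
    unfolding homogeneous_def xz_eq_scale by (simp add: map_value_def scale_def)
qed

section \<open>Flows from conjugation\<close>

lemma has_limit0_add:
  assumes "has_limit0 f a" "has_limit0 g b"
  shows "has_limit0 (f + g) (a + b)"
proof -
  obtain P Q where f: "f = Fract P Q" "poly Q 0 \<noteq> 0" "a = poly P 0 / poly Q 0"
    using assms(1) by (auto simp: has_limit0_def)
  obtain P' Q' where g: "g = Fract P' Q'" "poly Q' 0 \<noteq> 0" "b = poly P' 0 / poly Q' 0"
    using assms(2) by (auto simp: has_limit0_def)
  have "Q \<noteq> 0" "Q' \<noteq> 0" using f(2) g(2) by auto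
  then have "f + g = Fract (P * Q' + P' * Q) (Q * Q')" by (simp add: f(1) g(1))
  moreover have "a + b = poly (P * Q' + P' * Q) 0 / poly (Q * Q') 0"
    using f(2) g(2) unfolding f(3) g(3) by (simp add: add_frac_eq)
  moreover have "poly (Q * Q') 0 \<noteq> 0" using f g by simp
  ultimately show ?thesis unfolding has_limit0_def by blast
qed

lemma has_limit0_mult:
  assumes "has_limit0 f a" "has_limit0 g b"
  shows "has_limit0 (f * g) (a * b)"
proof -
  obtain P Q where f: "f = Fract P Q" "poly Q 0 \<noteq> 0" "a = poly P 0 / poly Q 0"
    using assms(1) by (auto simp: has_limit0_def)
  obtain P' Q' where g: "g = Fract P' Q'" "poly Q' 0 \<noteq> 0" "b = poly P' 0 / poly Q' 0"
    using assms(2) by (auto simp: has_limit0_def)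
  have "f * g = Fract (P * P') (Q * Q')" by (simp add: f(1) g(1))
  moreover have "a * b = poly (P * P') 0 / poly (Q * Q') 0"
    unfolding f(3) g(3) by simp
  moreover have "poly (Q * Q') 0 \<noteq> 0" using f g by simp
  ultimately show ?thesis unfolding has_limit0_def by blast
qed

lemma has_limit0_inverse:
  assumes "has_limit0 f a" "a \<noteq> 0"
  shows "has_limit0 (inverse f) (inverse a)"
proof -
  obtain P Q where f: "f = Fract P Q" "poly Q 0 \<noteq> 0" "a = poly P 0 / poly Q 0"
    using assms(1) by (auto simp: has_limit0_def)
  have "inverse f = Fract Q P" "poly P 0 \<noteq> 0" "inverse a = poly Q 0 / poly P 0"
    using f(1,2) assms(2) unfolding f(3) by simp_all
  then show ?thesis unfolding has_limit0_def by blast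
qed

lemma has_limit0_divide:
  "has_limit0 f a \<Longrightarrow> has_limit0 g b \<Longrightarrow> b \<noteq> 0 \<Longrightarrow> has_limit0 (f / g) (a / b)"
  unfolding divide_inverse by (intro has_limit0_mult has_limit0_inverse)

lemma has_limit0_to_fract: "has_limit0 (to_fract H) (poly H 0)"
  unfolding has_limit0_def to_fract_def by (rule exI[of _ H], rule exI[of _ 1]) simp

lemma has_limit0_emb: "has_limit0 (emb f) f"
  using has_limit0_to_fract[of "[:f:]"] by (simp add: emb_def)

lemma has_limit0_Z: "has_limit0 Z 0"
  using has_limit0_to_fract[of "[:0, 1:]"] by (simp add: Z_def)

lemma has_limit0_1: "has_limit0 1 1"
  using has_limit0_emb[of 1] by simp

lemma has_limit0_power: "has_limit0 f a \<Longrightarrow> has_limit0 (f ^ n) (a ^ n)"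
  by (induction n) (simp_all add: has_limit0_1 has_limit0_mult)

lemma has_limit0_power_int: "has_limit0 f a \<Longrightarrow> a \<noteq> 0 \<Longrightarrow> has_limit0 (f powi n) (a powi n)"
  by (auto simp: power_int_def has_limit0_power has_limit0_inverse)

lemma has_limit0_zero:
  assumes "has_limit0 0 a"
  shows "a = 0"
proof -
  obtain P Q where PQ: "0 = Fract P Q" "poly Q 0 \<noteq> 0" "a = poly P 0 / poly Q 0"
    using assms by (auto simp: has_limit0_def)
  then have "P = 0" by (auto simp: Fract_conv_to_fract eq_commute[of 0])
  then show "a = 0" using PQ(3) by simp
qed

lemma has_limit0_rf_value:
  assumes "generic const2 a" "has_limit0 (fst w) (fst a)" "has_limit0 (snd w) (snd a)"
  shows "has_limit0 (rf_value const3 f w) (rf_value const2 f a)"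
proof (cases f)
  case (Fract P Q)
  have lim: "has_limit0 (eval_poly2 const3 P w) (eval_poly2 const2 P a)" for P
    by (rule eval_poly2_rel[where R = has_limit0])
      (simp_all add: assms has_limit0_add has_limit0_mult const3_def has_limit0_emb const2_hom)
  have "eval_poly2 const2 Q a \<noteq> 0" using assms(1) Fract by (auto simp: generic_def)
  moreover from this have "eval_poly2 const3 Q w \<noteq> 0" using lim[of Q] has_limit0_zero by metis
  ultimately show ?thesis
    using has_limit0_divide[OF lim lim] assms(1) unfolding Fract(1)
    by (simp add: const2.rf_value_Fract_generic rf_value_Fract const3_hom)
qed

text \<open>Solves \<open>v = y/(y + 1)\<close> by \<open>y = v/(1 - v)\<close> and \<open>y + 1 = 1/(1 - v)\<close>.\<close>

definition phi_inv :: "int \<Rightarrow> ratmap" where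
  "phi_inv N = (X * (1 - Y) powi (N - 1), Y / (1 - Y))"

lemma (in real_hom) evals_cong: "evals h f p v \<Longrightarrow> v = v' \<Longrightarrow> evals h f p v'"
  by simp

lemma coordinates_nonzero: "Y \<noteq> 0" "X \<noteq> 0" "Y + 1 \<noteq> 0" "1 - Y \<noteq> 0"
proof -
  show "Y \<noteq> 0" "X \<noteq> 0" using const2.generic_nonzero[OF generic_XY] by simp_all
  have "Y + 1 = to_fract ([:0,1:] + 1)" "1 - Y = to_fract (1 - [:0,1:])"
    unfolding Y_def by (simp_all only: to_fract_add to_fract_diff to_fract_1)
  then show "Y + 1 \<noteq> 0" "1 - Y \<noteq> 0" by (simp_all add: one_pCons)
qed

lemma inverse_maps_phi: "inverse_maps (phi N) (phi_inv N)"
proof -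
  have e1: "Y / (1 - Y) + 1 = inverse (1 - Y)"
    using coordinates_nonzero by (simp add: field_simps)
  have e2: "1 - Y / (Y + 1) = inverse (Y + 1)"
    using coordinates_nonzero by (simp add: field_simps)
  note nz = coordinates_nonzero
  have A: "evals const2 (Y + 1) (phi_inv N) (inverse (1 - Y))"
    using const2.evals_add[OF const2.evals_Y[of "phi_inv N"] const2.evals_1]
    by (simp add: phi_inv_def e1)
  have B: "evals const2 (1 - Y) (phi N) (inverse (Y + 1))"
    using const2.evals_diff[OF const2.evals_1 const2.evals_Y[of "phi N"]]
    by (simp add: phi_def e2)
  show ?thesis
  proof (rule inverse_mapsI)
    show "evals const2 (fst (phi N)) (phi_inv N) X"
      unfolding phi_def fst_conv
      by (rule const2.evals_cong[OF const2.evals_mult[OF const2.evals_X const2.evals_power_int[OF A]]])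
        (use nz in \<open>simp_all add: phi_inv_def power_int_inverse\<close>)
    show "evals const2 (snd (phi N)) (phi_inv N) Y"
      unfolding phi_def snd_conv
      by (rule const2.evals_cong[OF const2.evals_divide[OF const2.evals_Y A]])
        (use nz in \<open>simp_all add: phi_inv_def\<close>)
    show "evals const2 (fst (phi_inv N)) (phi N) X"
      unfolding phi_inv_def fst_conv
      by (rule const2.evals_cong[OF const2.evals_mult[OF const2.evals_X const2.evals_power_int[OF B]]])
        (use nz in \<open>simp_all add: phi_def power_int_inverse\<close>)
    show "evals const2 (snd (phi_inv N)) (phi N) Y"
      unfolding phi_inv_def snd_conv
      by (rule const2.evals_cong[OF const2.evals_divide[OF const2.evals_Y B]])
        (use nz in \<open>simp_all add: phi_def\<close>)
  qed
qed

lemma generic_phi: "generic const2 (phi N)" and generic_phi_inv: "generic const2 (phi_inv N)"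
  using inverse_maps_generic[OF inverse_maps_phi] by auto

lemma (in real_hom) map_value_phi:
  "generic h p \<Longrightarrow> map_value h (phi N) p = (fst p * (snd p + 1) powi (N - 1), snd p / (snd p + 1))"
  by (simp add: map_value_def phi_def rf_value_hom rf_value_simps)

lemma (in real_hom) map_value_phi_inv:
  "generic h p \<Longrightarrow> map_value h (phi_inv N) p = (fst p * (1 - snd p) powi (N - 1), snd p / (1 - snd p))"
  by (simp add: map_value_def phi_inv_def rf_value_hom rf_value_simps)

lemma (in real_hom) generic_snd_plus_1_nonzero: "generic h p \<Longrightarrow> snd p + 1 \<noteq> 0"
  using rf_value_eq_0_iff[of p "Y + 1"] coordinates_nonzero
  by (simp add: rf_value_hom rf_value_simps)

text \<open>
The flow equation of \<open>phi N\<close> along the ray through \<open>w\<close>, with the outer \<open>phi N\<close> moved to the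
other side. In this form it also exhibits the inner point \<open>((1 - z)/z) \<cdot> phi N (z w)\<close> as the image of a
generic point under a generic map, so that every map can be evaluated there.
\<close>

lemma phi_flow_equation:
  assumes "generic const2 w"
  shows "scale ((1 - Z) / Z) (map_value const3 (phi N) (scale Z (emb_map w))) =
    map_value const3 (phi_inv N) (scale (1 - Z) (emb_map (phi N \<circ>\<^sub>R w)))"
proof -
  define a b where "a = emb (fst w)" and "b = emb (snd w)"
  have g: "generic const3 (scale Z (emb_map w))" by (rule generic_scale_Z[OF assms])
  have g': "generic const3 (scale (1 - Z) (emb_map (phi N \<circ>\<^sub>R w)))"
    by (intro generic_scale_1_minus_Z generic_rcomp generic_phi assms)
  have b1: "b + 1 \<noteq> 0"
    using const3.generic_snd_plus_1_nonzero[OF generic_emb_map[OF assms]] by (simp add: b_def)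
  have Zb1: "Z * b + 1 \<noteq> 0"
    using const3.generic_snd_plus_1_nonzero[OF g] by (simp add: b_def scale_def)
  have w: "emb_map (phi N \<circ>\<^sub>R w) = (a * (b + 1) powi (N - 1), b / (b + 1))"
    using const3.map_value_phi[OF generic_emb_map[OF assms], of N] map_value_emb_map[OF assms, of "phi N"]
    by (simp add: a_def b_def)
  have e: "1 - (1 - Z) * (b / (b + 1)) = (Z * b + 1) / (b + 1)"
    using b1 by (simp add: field_simps)
  have q: "map_value const3 (phi_inv N) (scale (1 - Z) (emb_map (phi N \<circ>\<^sub>R w))) =
      ((1 - Z) * (a * (b + 1) powi (N - 1)) * ((Z * b + 1) / (b + 1)) powi (N - 1),
       (1 - Z) * (b / (b + 1)) / ((Z * b + 1) / (b + 1)))"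
    unfolding const3.map_value_phi_inv[OF g'] unfolding w scale_def fst_conv snd_conv e ..
  show ?thesis
    unfolding const3.map_value_phi[OF g] q
    using b1 Zb1 by (simp add: scale_def power_int_divide_distrib flip: a_def b_def)
qed

text \<open>
Let \<open>\<phi>\<close> be the conjugate. As \<open>l\<close> and \<open>m\<close> commute with scalars, \<open>((1 - z)/z) \<cdot> \<phi>(xz)\<close> is the
image under \<open>m\<close> of the inner point for \<open>phi N\<close> on the ray through \<open>l\<close>. Then \<open>\<phi>\<close> sends it to \<open>m((1 - z) \<cdot> phi N (l))\<close>, and the
scalar can be pulled out again.
\<close>

lemma conj_phi_flow:
  assumes "inverse_maps l m" "homogeneous 1 (fst l)" "homogeneous 1 (snd l)"
  shows "flow (m \<circ>\<^sub>R phi N \<circ>\<^sub>R l)"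
proof -
  define \<phi> where "\<phi> = m \<circ>\<^sub>R phi N \<circ>\<^sub>R l"
  have g [simp]: "generic const2 l" "generic const2 m" "generic const2 (phi N)"
    "generic const2 (phi_inv N)"
    using inverse_maps_generic[OF assms(1)] generic_phi generic_phi_inv by auto
  have lm: "l \<circ>\<^sub>R m = (X, Y)" "m \<circ>\<^sub>R l = (X, Y)" and pp: "phi N \<circ>\<^sub>R phi_inv N = (X, Y)"
    using assms(1) inverse_maps_phi[of N] by (auto simp: inverse_maps_def)
  have hm: "homogeneous 1 (fst m)" "homogeneous 1 (snd m)"
    using homogeneous_inverse assms by auto
  have \<phi>: "map_value const3 \<phi> p = map_value const3 m (map_value const3 (phi N) (map_value const3 l p))"
    if "generic const3 p" for p
    using that by (simp add: \<phi>_def const3.map_value_rcomp generic_rcomp const3.generic_map_value)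
  have l_Z: "map_value const3 l (emb X * Z, emb Y * Z) = scale Z (emb_map l)"
    unfolding xz_eq_scale
    using assms by (simp add: map_value_scale3 generic_emb_map[OF generic_XY] map_value_emb_map[OF generic_XY]
        del: fst_conv snd_conv)
  define p where "p = map_value const3 (phi N) (scale Z (emb_map l))"
  have gp: "generic const3 p" unfolding p_def
    by (simp add: const3.generic_map_value generic_scale_Z)
  have at_xz: "at_xz \<phi> = map_value const3 m p"
    unfolding at_xz_def by (simp only: \<phi>[OF generic_xz] l_Z p_def)
  define v where "v = scale (1 - Z) (emb_map (phi N \<circ>\<^sub>R l))"
  have gv: "generic const3 v" unfolding v_def
    by (intro generic_scale_1_minus_Z generic_rcomp) simp_all
  have v: "map_value const3 m v = scale (1 - Z) (emb_map \<phi>)"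
  proof -
    have "map_value const3 m v = scale (1 - Z) (map_value const3 m (emb_map (phi N \<circ>\<^sub>R l)))"
      unfolding v_def using hm by (intro map_value_scale3 generic_emb_map generic_rcomp) simp_all
    also have "map_value const3 m (emb_map (phi N \<circ>\<^sub>R l)) = emb_map (m \<circ>\<^sub>R (phi N \<circ>\<^sub>R l))"
      by (intro map_value_emb_map generic_rcomp) simp_all
    finally show ?thesis by (simp add: \<phi>_def rcomp_assoc)
  qed
  \<comment> \<open>\<open>q\<close> is the inner point for \<open>phi N\<close>, and \<open>m\<close> takes it to the one for \<open>\<phi>\<close>.\<close>
  define q where "q = map_value const3 (phi_inv N) v"
  have gq: "generic const3 q" unfolding q_def by (simp add: const3.generic_map_value gv)
  have inner: "scale ((1 - Z) / Z) (at_xz \<phi>) = map_value const3 m q"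
  proof -
    have "scale ((1 - Z) / Z) (at_xz \<phi>) = map_value const3 m (scale ((1 - Z) / Z) p)"
      unfolding at_xz using hm gp by (intro map_value_scale3[symmetric]) simp_all
    also have "scale ((1 - Z) / Z) p = q"
      unfolding p_def q_def v_def by (rule phi_flow_equation) simp
    finally show ?thesis .
  qed
  have gmq: "generic const3 (map_value const3 m q)" by (simp add: const3.generic_map_value gq)
  have "map_value const3 \<phi> (map_value const3 m q) =
      map_value const3 m (map_value const3 (phi N) (map_value const3 (l \<circ>\<^sub>R m) q))"
    by (simp add: \<phi> gmq const3.map_value_rcomp gq)
  also have "map_value const3 (l \<circ>\<^sub>R m) q = q"
    by (simp add: lm map_value_def const3.rf_value_simps)
  also have "map_value const3 (phi N) q = map_value const3 (phi N \<circ>\<^sub>R phi_inv N) v"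
    by (simp add: q_def const3.map_value_rcomp gv)
  also have "\<dots> = v" by (simp add: pp map_value_def const3.rf_value_simps)
  finally have eq: "scale (1 - Z) (emb_map \<phi>) = map_value const3 \<phi> (scale ((1 - Z) / Z) (at_xz \<phi>))"
    using v inner by simp
  have def: "map_defined const3 \<phi> (scale ((1 - Z) / Z) (at_xz \<phi>))"
    unfolding inner by (rule const3.generic_map_defined[OF gmq])
  \<comment> \<open>\<open>p'\<close> is \<open>phi N (z l)/z\<close>, which has the limit \<open>l\<close>; applying \<open>m\<close> gives the limit of \<open>\<phi>(xz)/z\<close>.\<close>
  define p' where "p' = (emb (fst l) * (Z * emb (snd l) + 1) powi (N - 1),
      emb (snd l) / (Z * emb (snd l) + 1))"
  have lim: "has_limit0 (Z * emb (snd l) + 1) 1"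
    using has_limit0_add[OF has_limit0_mult[OF has_limit0_Z has_limit0_emb] has_limit0_1] by force
  have lim_fst: "has_limit0 (fst p') (fst l)"
    using has_limit0_mult[OF has_limit0_emb has_limit0_power_int[OF lim]] by (force simp: p'_def)
  have lim_snd: "has_limit0 (snd p') (snd l)"
    using has_limit0_divide[OF has_limit0_emb lim] by (force simp: p'_def)
  have "scale (1 / Z) (at_xz \<phi>) = map_value const3 m (scale (1 / Z) p)"
    unfolding at_xz using hm gp by (intro map_value_scale3[symmetric]) simp_all
  also have "scale (1 / Z) p = p'"
    unfolding p_def p'_def const3.map_value_phi[OF generic_scale_Z[OF g(1)]]
    by (simp add: scale_def)
  finally have "fst (at_xz \<phi>) / Z = rf_value const3 (fst m) p'" "snd (at_xz \<phi>) / Z = rf_value const3 (snd m) p'"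
    by (simp_all add: scale_def map_value_def)
  moreover have "rf_value const2 (fst m) l = X" "rf_value const2 (snd m) l = Y"
    using lm(2) by (simp_all add: rcomp_def map_value_def)
  ultimately have "has_limit0 (fst (at_xz \<phi>) / Z) X" "has_limit0 (snd (at_xz \<phi>) / Z) Y"
    using has_limit0_rf_value[OF g(1) lim_fst lim_snd] by metis+
  moreover have "\<phi> \<noteq> (X, Y)"
  proof
    assume "\<phi> = (X, Y)"
    then have "l \<circ>\<^sub>R \<phi> \<circ>\<^sub>R m = (X, Y)" by (simp add: lm)
    moreover have "l \<circ>\<^sub>R \<phi> \<circ>\<^sub>R m = l \<circ>\<^sub>R m \<circ>\<^sub>R (phi N \<circ>\<^sub>R (l \<circ>\<^sub>R m))"
      by (simp add: \<phi>_def rcomp_assoc generic_rcomp del: lm)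
    ultimately have "phi N = (X, Y)" by (simp add: lm)
    then show False using coordinates_nonzero by (simp add: phi_def divide_eq_eq)
  qed
  ultimately show ?thesis
    using eq def unfolding flow_def \<phi>_def[symmetric] by blast
qed

lemma homogeneous_rcomp:
  assumes "homogeneous 1 f" "generic const2 l" "homogeneous 1 (fst l)" "homogeneous 1 (snd l)"
  shows "homogeneous 1 (rf_value const2 f l)"
proof -
  have "map_value const3 l (emb X * Z, emb Y * Z) = (Z * fst (emb_map l), Z * snd (emb_map l))"
    using assms(3,4) by (simp add: homogeneous_def map_value_def)
  then show ?thesis
    using const3.evals_value[OF const3.evals_scale_1[OF assms(1) generic_emb_map[OF assms(2)], of Z]]
    by (simp add: homogeneous_def const3.rf_value_comp assms generic_xz rf_value_emb_map)
qed

section \<open>The symmetric normal forms\<close>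

lemma (in real_hom) evals_numeral: "evals h (numeral n) p (numeral n)"
  by (induction n) (simp_all only: numeral.simps evals_1 evals_add)

lemma inverse_maps_half_sum_diff:
  "inverse_maps (X - Y, X + Y) ((X + Y) / 2, (Y - X) / 2)"
  by (rule inverse_mapsI; unfold fst_conv snd_conv; rule const2.evals_cong)
    ((rule const2.evals_intros const2.evals_numeral | (simp add: field_simps; fail))+)

lemma sum_diff_nonzero: "X + Y \<noteq> 0" "X - Y \<noteq> 0"
  using const2.generic_nonzero[of "(X - Y, X + Y)"] inverse_maps_generic[OF inverse_maps_half_sum_diff]
  by auto

lemma inverse_maps_square_over_diff:
  "inverse_maps ((X + Y)\<^sup>2 / (X - Y), X + Y) ((Y + Y\<^sup>2 / X) / 2, (Y - Y\<^sup>2 / X) / 2)"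
proof -
  have "X \<noteq> Y" using sum_diff_nonzero by simp
  note nz = this sum_diff_nonzero coordinates_nonzero
  have diff: "(Y + Y\<^sup>2 / X) / 2 - (Y - Y\<^sup>2 / X) / 2 = Y\<^sup>2 / X"
    and sum: "(Y + Y\<^sup>2 / X) / 2 + (Y - Y\<^sup>2 / X) / 2 = Y"
    and frac: "(X + Y)\<^sup>2 / ((X + Y)\<^sup>2 / (X - Y)) = X - Y"
    using nz by (simp_all add: field_simps)
  show ?thesis
    by (rule inverse_mapsI; unfold fst_conv snd_conv; rule const2.evals_cong)
      ((rule const2.evals_intros const2.evals_numeral | (simp add: nz diff sum frac; fail))+)
qed

text \<open>
In the coordinates \<open>d = x - y\<close> and \<open>s = x + y\<close> the flow \<open>Phi M\<close> is the triangular map that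
multiplies \<open>d\<close> by \<open>(s + 1) powi (- M - 1)\<close> and sends \<open>s\<close> to \<open>s/(s + 1)\<close>. For \<open>M = - N\<close> this is \<open>phi N\<close>.
For \<open>M = N\<close> it becomes \<open>phi N\<close> after \<open>d\<close> is replaced by \<open>s\<^sup>2/d\<close>, which is again homogeneous of
degree 1 and is multiplied by \<open>(s + 1) powi (N - 1)\<close>.
\<close>

lemma Phi_minus_conj:
  "((X + Y) / 2, (Y - X) / 2) \<circ>\<^sub>R (phi N \<circ>\<^sub>R (X - Y, X + Y)) = Phi (- N)"
proof -
  have g: "generic const2 (X - Y, X + Y)"
    using inverse_maps_generic[OF inverse_maps_half_sum_diff] by blast
  define s d where "s = X + Y + 1" and "d = X - Y"
  have s: "s \<noteq> 0"
    using const2.generic_snd_plus_1_nonzero[OF g] by (simp add: s_def)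
  have "phi N \<circ>\<^sub>R (X - Y, X + Y) = (d * s powi (N - 1), (X + Y) / s)"
    using const2.map_value_phi[OF g] by (simp add: rcomp_def s_def d_def)
  moreover have "generic const2 (phi N \<circ>\<^sub>R (X - Y, X + Y))" by (rule generic_rcomp[OF generic_phi g])
  moreover have "s powi (N - 1) = s powi N / s" "s powi (- N) = inverse (s powi N)"
    "s powi (- N + 1) = s / s powi N"
    using s by (simp_all add: power_int_diff power_int_add power_int_minus divide_inverse)
  moreover have "(inverse (s powi N) * (X + Y) + d) / (2 * (s / s powi N)) = ((X + Y) / s + d * (s powi N / s)) / 2"
    "(inverse (s powi N) * (X + Y) - d) / (2 * (s / s powi N)) = ((X + Y) / s - d * (s powi N / s)) / 2"
    using s by (simp_all add: field_simps)
  moreover have "Phi (- N) = ((s powi (- N) * (X + Y) + d) / (2 * s powi (- N + 1)),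
      (s powi (- N) * (X + Y) - d) / (2 * s powi (- N + 1)))"
    unfolding Phi_def s_def d_def by (simp add: algebra_simps)
  ultimately show ?thesis
    unfolding rcomp_def[of "((X + Y) / 2, (Y - X) / 2)"] map_value_def
    by (simp only: const2.rf_value_hom const2.rf_value_simps const2.rf_value_numeral fst_conv snd_conv add.commute)
qed

lemma Phi_plus_conj:
  "((Y + Y\<^sup>2 / X) / 2, (Y - Y\<^sup>2 / X) / 2) \<circ>\<^sub>R (phi N \<circ>\<^sub>R ((X + Y)\<^sup>2 / (X - Y), X + Y)) = Phi N"
proof -
  have g: "generic const2 ((X + Y)\<^sup>2 / (X - Y), X + Y)"
    using inverse_maps_generic[OF inverse_maps_square_over_diff] by blast
  define s d where "s = X + Y + 1" and "d = X - Y"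
  have s: "s \<noteq> 0" and d: "d \<noteq> 0" and sum: "X + Y \<noteq> 0"
    using const2.generic_snd_plus_1_nonzero[OF g] sum_diff_nonzero by (simp_all add: s_def d_def)
  have "phi N \<circ>\<^sub>R ((X + Y)\<^sup>2 / (X - Y), X + Y) = ((X + Y)\<^sup>2 / d * s powi (N - 1), (X + Y) / s)"
    using const2.map_value_phi[OF g] by (simp add: rcomp_def s_def d_def)
  moreover have "generic const2 (phi N \<circ>\<^sub>R ((X + Y)\<^sup>2 / (X - Y), X + Y))"
    by (rule generic_rcomp[OF generic_phi g])
  moreover have pw: "s powi (N - 1) = s powi N / s" "s powi (N + 1) = s powi N * s"
    using s by (simp_all add: power_int_diff power_int_add)
  moreover have "((X + Y) / s)\<^sup>2 / ((X + Y)\<^sup>2 / d * (s powi N / s)) = d / (s powi N * s)"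
    using s d sum by (simp add: power2_eq_square)
  moreover have "(s powi N * (X + Y) + d) / (2 * (s powi N * s)) = ((X + Y) / s + d / (s powi N * s)) / 2"
    "(s powi N * (X + Y) - d) / (2 * (s powi N * s)) = ((X + Y) / s - d / (s powi N * s)) / 2"
    using s by (simp_all add: field_simps)
  moreover have "Phi N = ((s powi N * (X + Y) + d) / (2 * s powi (N + 1)),
      (s powi N * (X + Y) - d) / (2 * s powi (N + 1)))"
    unfolding Phi_def s_def d_def by (simp add: algebra_simps)
  ultimately show ?thesis
    unfolding rcomp_def[of "((Y + Y\<^sup>2 / X) / 2, (Y - Y\<^sup>2 / X) / 2)"] map_value_def
    by (simp add: const2.rf_value_hom const2.rf_value_simps const2.rf_value_numeral)
qed

lemma homogeneous_sum_diff: "homogeneous 1 (X + Y)" "homogeneous 1 (X - Y)"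
  by (intro homogeneous_add homogeneous_diff homogeneous_X homogeneous_Y)+

lemma homogeneous_square_over_diff: "homogeneous 1 ((X + Y)\<^sup>2 / (X - Y))"
  using homogeneous_divide[OF homogeneous_mult[OF homogeneous_sum_diff(1,1)] homogeneous_sum_diff(2)]
  by (simp add: power2_eq_square)

lemma inverse_maps_scaling:
  assumes "homogeneous 0 A" "A \<noteq> 0"
  shows "inverse_maps (X * A, Y * A) (X / A, Y / A)"
proof -
  have 1: "evals const2 A (X * A, Y * A) A"
    using const2.evals_scale_0[OF assms(1) generic_XY assms(2)] by (simp add: mult.commute)
  have 2: "evals const2 A (X / A, Y / A) A"
    using const2.evals_scale_0[OF assms(1) generic_XY, of "inverse A"] assms(2)
    by (simp add: divide_inverse mult.commute)
  show ?thesis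
    by (rule inverse_mapsI; unfold fst_conv snd_conv; rule const2.evals_cong)
      ((rule const2.evals_intros 1 2 | (simp add: assms; fail))+)
qed

section \<open>Maps commuting with \<open>phi N\<close>\<close>

lemma (in real_hom) eval_poly2_monom:
  "eval_poly2 h (monom c n) p = poly (map_poly h c) (fst p) * snd p ^ n"
  by (simp add: eval_poly2_def map_poly_monom poly_monom)

lemma (in real_hom) eval_poly2_pcompose:
  "eval_poly2 h (pcompose (map_poly (\<lambda>c. [:c:]) p) R) w = poly (map_poly h p) (eval_poly2 h R w)"
proof (induction p)
  case (pCons a p)
  then show ?case
    by (simp add: map_poly_pCons pcompose_pCons eval_poly2_simps)
qed (simp add: eval_poly2_simps)

text \<open>
  With \<open>t\<close> and \<open>s\<close> algebraically independent, an identity \<open>p(t s\<^sup>n) f(t) s\<^sup>j = q(t s\<^sup>n) g(t) s\<^sup>k\<close> is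
  an identity of polynomials in \<open>s\<close>, whose degrees and leading coefficients can be compared.
\<close>

lemma compare_in_second_variable:
  fixes p q f g :: "real poly" and n j k :: nat
  assumes h: "real_hom h" and ts: "generic h (t, s)" and n: "n > 0"
    and nz: "p \<noteq> 0" "q \<noteq> 0" "f \<noteq> 0" "g \<noteq> 0"
    and eq: "poly (map_poly h p) (t * s ^ n) * poly (map_poly h f) t * s ^ j =
             poly (map_poly h q) (t * s ^ n) * poly (map_poly h g) t * s ^ k"
  shows "degree p * n + j = degree q * n + k"
    and "monom (lead_coeff p) (degree p) * f = monom (lead_coeff q) (degree q) * g"
proof -
  interpret real_hom h by (rule h)
  \<comment> \<open>\<open>B p\<close> is the polynomial \<open>p(u v\<^sup>n)\<close> in \<open>v\<close> over \<open>\<real>[u]\<close>.\<close>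
  define B where "B p = pcompose (map_poly (\<lambda>c. [:c:]) p) (monom [:0, 1:] n)" for p :: "real poly"
  have B: "eval_poly2 h (B p) (t, s) = poly (map_poly h p) (t * s ^ n)" for p
    by (simp add: B_def eval_poly2_pcompose eval_poly2_monom map_poly_pCons)
  have deg: "degree (B p) = degree p * n" for p
    by (simp add: B_def degree_pcompose degree_map_poly degree_monom_eq)
  have monom: "monom a d = [:a:] * [:0, 1:] ^ d" for a :: real and d
    by (simp add: monom_altdef)
  have lead: "lead_coeff (B p) = monom (lead_coeff p) (degree p)" for p
    using n by (simp add: B_def lead_coeff_comp degree_monom_eq degree_map_poly coeff_map_poly monom)
  have nzB: "B p \<noteq> 0" if "p \<noteq> 0" for p
    using lead[of p] that by (metis leading_coeff_0_iff monom_eq_0_iff)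
  have "eval_poly2 h (B p * monom f j - B q * monom g k) (t, s) = 0"
    using eq by (simp add: eval_poly2_simps eval_poly2_monom B diff_conv_add_uminus[of "B p * _"]
        del: add_uminus_conv_diff) (simp add: mult.assoc)
  then have P: "B p * monom f j = B q * monom g k"
    using ts unfolding generic_def by (metis eq_iff_diff_eq_0)
  have d1: "degree (B p * monom f j) = degree p * n + j"
    using nz nzB by (simp add: degree_mult_eq deg degree_monom_eq)
  have d2: "degree (B q * monom g k) = degree q * n + k"
    using nz nzB by (simp add: degree_mult_eq deg degree_monom_eq)
  show "degree p * n + j = degree q * n + k" using P d1 d2 by simp
  have "lead_coeff (B p * monom f j) = lead_coeff (B q * monom g k)" using P by simp
  then show "monom (lead_coeff p) (degree p) * f = monom (lead_coeff q) (degree q) * g"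
    by (simp only: lead_coeff_mult lead lead_coeff_monom)
qed

text \<open>
Write \<open>t = x/y\<close>, \<open>s = y + 1\<close> and \<open>j = (y \<alpha>(t), y \<beta>(t))\<close>. As \<open>phi N\<close> takes \<open>t\<close> to \<open>t s\<^sup>N\<close>, the
second components of the two compositions agree iff \<open>\<delta>(t s\<^sup>N) s = \<delta>(t)\<close> for \<open>\<delta> = 1/\<beta> - 1\<close>. If
\<open>\<delta> \<noteq> 0\<close>, comparing degrees in \<open>s\<close> would give \<open>N deg \<delta> = - 1\<close>, which is excluded by \<open>N \<ge> 2\<close>; hence
\<open>\<beta> = 1\<close>. The first components then give \<open>\<alpha>(t s\<^sup>N) = s\<^sup>N \<alpha>(t)\<close>, and comparing leading
coefficients in \<open>s\<close> makes \<open>\<alpha>(t)\<close> a multiple of \<open>t\<close>.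
\<close>

lemma centraliser_phi:
  assumes N: "N \<ge> 2" and j: "generic const2 j" "homogeneous 1 (fst j)" "homogeneous 1 (snd j)"
    and comm: "phi N \<circ>\<^sub>R j = j \<circ>\<^sub>R phi N"
  obtains c where "j = (const2 c * X, Y)"
proof -
  define n where "n = nat N"
  have n: "n \<ge> 2" "N = int n" using N by (auto simp: n_def)
  define T S where "T = X / Y" and "S = Y + 1"
  have TS: "generic const2 (T, S)" unfolding T_def S_def by (rule generic_ratio_shift)
  note nz = coordinates_nonzero
  have S: "S \<noteq> 0" using nz by (simp add: S_def)
  let ?e = "\<lambda>p::real poly. poly (map_poly const2 p)"
  have e0: "?e p T = 0 \<longleftrightarrow> p = 0" for p unfolding T_def by (rule poly_ratio_eq_0_iff)
  have pw: "S powi (N - 1) * S = S ^ n"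
    using S by (simp add: n(2) power_int_diff)
  have T_phi: "rf_value const2 T (phi N) = T * S ^ n"
    unfolding T_def const2.rf_value_hom(5)[OF generic_phi] const2.rf_value_simps
    using nz S by (simp add: phi_def flip: S_def pw)
  have ratio_phi: "rf_value const2 (Y * (?e p T / ?e q T)) (phi N) =
      Y / S * (?e p (T * S ^ n) / ?e q (T * S ^ n))" for p q
    by (simp add: const2.rf_value_hom[OF generic_phi] const2.rf_value_simps T_phi)
      (simp add: phi_def S_def)
  have e0': "?e p (T * S ^ n) = 0 \<longleftrightarrow> p = 0" for p
    using const2.rf_value_eq_0_iff[OF generic_phi, of "?e p T" N] e0
    by (simp add: const2.rf_value_hom[OF generic_phi] T_phi)
  have j0: "fst j \<noteq> 0" "snd j \<noteq> 0" using const2.generic_nonzero[OF j(1)] by auto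
  have comm1: "fst j * (snd j + 1) powi (N - 1) = rf_value const2 (fst j) (phi N)"
    and comm2: "snd j / (snd j + 1) = rf_value const2 (snd j) (phi N)"
    using comm const2.map_value_phi[OF j(1), of N] by (simp_all add: rcomp_def map_value_def)

  obtain p q where pq: "q \<noteq> 0" "snd j = Y * (?e p T / ?e q T)"
    using homogeneous_ratio[OF j(3)] unfolding T_def by metis
  have p0: "p \<noteq> 0" using j0 pq by auto
  have "p = q"
  proof (rule ccontr)
    assume "p \<noteq> q"
    define a b a' b' where "a = ?e p T" and "b = ?e q T"
      and "a' = ?e p (T * S ^ n)" and "b' = ?e q (T * S ^ n)"
    have nz': "a \<noteq> 0" "b \<noteq> 0" "a' \<noteq> 0" "b' \<noteq> 0"
      using p0 pq(1) by (simp_all add: a_def b_def a'_def b'_def e0 e0')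
    have Y: "Y = S - 1" by (simp add: S_def)
    have "snd j + 1 \<noteq> 0" by (rule const2.generic_snd_plus_1_nonzero[OF j(1)])
    moreover have "snd j = Y * (a / b)" using pq(2) by (simp add: a_def b_def)
    moreover have "snd j / (snd j + 1) = Y / S * (a' / b')"
      using comm2 unfolding pq(2) ratio_phi by (simp add: a'_def b'_def a_def b_def)
    ultimately have "Y * a + b \<noteq> 0" "Y * a / (Y * a + b) = Y * a' / (S * b')"
      using nz' by (simp_all add: add_divide_eq_if_simps)
    then have "Y * a * (S * b') = Y * a' * (Y * a + b)"
      using nz' S by (simp add: frac_eq_eq)
    then have "a * S * b' = a' * (Y * a + b)" using nz by simp
    then have "(b' - a') * a * S = a' * (b - a)"
      unfolding Y by (simp add: algebra_simps)
    \<comment> \<open>With \<open>\<delta> = (q - p)/p\<close> this is \<open>\<delta>(t s\<^sup>n) s = \<delta>(t)\<close>, cleared of denominators.\<close>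
    then have "?e (q - p) (T * S ^ n) * ?e p T * S ^ 1 = ?e p (T * S ^ n) * ?e (q - p) T * S ^ 0"
      using const2.poly_map_poly_simps(1)[of "q - p" p]
      by (simp add: a_def b_def a'_def b'_def algebra_simps)
    then have "degree (q - p) * n + 1 = degree p * n + 0"
      using \<open>p \<noteq> q\<close> p0 n TS
      by (intro compare_in_second_variable(1)[where h = const2 and f = p and g = "q - p", OF const2.real_hom_axioms TS]) auto
    then have "n dvd 1" by (metis add_0_right dvd_add_right_iff dvd_triv_right)
    then show False using n by simp
  qed
  then have snd_j: "snd j = Y" using pq by (simp add: e0)

  obtain u v where uv: "v \<noteq> 0" "fst j = Y * (?e u T / ?e v T)"
    using homogeneous_ratio[OF j(2)] unfolding T_def by metis
  have u0: "u \<noteq> 0" using j0 uv by auto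
  have "Y * (?e u T / ?e v T) * S powi (N - 1) * S = Y / S * (?e u (T * S ^ n) / ?e v (T * S ^ n)) * S"
    using comm1 unfolding snd_j uv(2) ratio_phi by (simp add: S_def)
  then have "Y * (?e u T / ?e v T) * (S powi (N - 1) * S) = Y * (?e u (T * S ^ n) / ?e v (T * S ^ n))"
    using S by (simp add: mult.assoc)
  then have "?e u T / ?e v T * S ^ n = ?e u (T * S ^ n) / ?e v (T * S ^ n)"
    unfolding pw mult.assoc mult_left_cancel[OF nz(1)] .
  then have eq: "?e u (T * S ^ n) * ?e v T * S ^ 0 = ?e v (T * S ^ n) * ?e u T * S ^ n"
    using e0 e0' uv(1) by (simp add: field_simps)
  note cmp = compare_in_second_variable[OF const2.real_hom_axioms TS _ u0 uv(1) uv(1) u0 eq]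
  have "degree u * n = Suc (degree v) * n" using cmp(1) n by simp
  then have deg: "degree u = Suc (degree v)" using n by (metis mult_cancel2 not_numeral_le_zero)
  have "monom (lead_coeff u) (degree u) * v = monom (lead_coeff v) (degree v) * u"
    using cmp(2) n by simp
  then have "?e (monom (lead_coeff u) (degree u) * v) T = ?e (monom (lead_coeff v) (degree v) * u) T"
    by simp
  then have "const2 (lead_coeff u) * T ^ Suc (degree v) * ?e v T =
      const2 (lead_coeff v) * T ^ degree v * ?e u T"
    by (simp add: const2.poly_map_poly_simps map_poly_monom const2_hom poly_monom deg)
  moreover have T: "T \<noteq> 0" using nz by (simp add: T_def)
  ultimately have lead: "const2 (lead_coeff u) * T * ?e v T = const2 (lead_coeff v) * ?e u T"
    by (simp add: mult.assoc mult.left_commute)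
  have lv: "const2 (lead_coeff v) \<noteq> 0" using uv(1) const2.nonzero by simp
  define c where "c = lead_coeff u / lead_coeff v"
  have "c * lead_coeff v = lead_coeff u" using uv(1) by (simp add: c_def)
  then have "const2 c * const2 (lead_coeff v) = const2 (lead_coeff u)"
    by (metis const2_hom(4))
  moreover have "const2 (lead_coeff v) * (const2 c * T * ?e v T) =
      const2 c * const2 (lead_coeff v) * T * ?e v T" by (simp only: mult_ac)
  ultimately have "const2 (lead_coeff v) * (const2 c * T * ?e v T) = const2 (lead_coeff v) * ?e u T"
    by (simp only: lead)
  then have "const2 c * T * ?e v T = ?e u T" using lv by simp
  then have "?e u T / ?e v T = const2 c * T" using e0 uv(1) by (simp add: divide_eq_eq)
  then have "fst j = const2 c * X" using uv(2) nz by (simp add: T_def)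
  then show ?thesis using that snd_j by (metis prod.collapse)
qed

section \<open>Invertible rational functions of one variable\<close>

text \<open>
  This is the rational root theorem over \<open>\<real>[t]\<close>. If \<open>f(g(t)) = t\<close> for \<open>f = a/b\<close>, then \<open>g = c/d\<close> is
  a root of the polynomial with the coefficients \<open>a\<^sub>i - t b\<^sub>i\<close>, which are linear in \<open>t\<close>; and \<open>c\<close>
  divides the lowest, \<open>d\<close> the highest of them.
\<close>

lemma left_invertible_degree_le_1:
  fixes a b c d :: "real poly"
  assumes h: "real_hom h" and t: "\<And>q. poly (map_poly h q) t = 0 \<Longrightarrow> q = 0"
    and cop: "coprime a b" "coprime c d" and d: "d \<noteq> 0"
    and g: "g = poly (map_poly h c) t / poly (map_poly h d) t"
    and bg: "poly (map_poly h b) g \<noteq> 0"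
    and inv: "poly (map_poly h a) g / poly (map_poly h b) g = t"
  shows "degree c \<le> 1 \<and> degree d \<le> 1"
proof -
  interpret real_hom h by (rule h)
  define n where "n = max (degree a) (degree b)"
  \<comment> \<open>\<open>H p\<close> is \<open>p(c/d)\<close> cleared of denominators.\<close>
  define H where "H p = (\<Sum>i\<le>n. smult (coeff p i) (c ^ i * d ^ (n - i)))" for p :: "real poly"
  let ?e = "\<lambda>p. poly (map_poly h p) t"
  have dt: "?e d \<noteq> 0" using t d by blast
  have pw: "?e (p ^ k) = ?e p ^ k" for p :: "real poly" and k
    by (induction k) (simp_all add: poly_map_poly_simps)
  have sm: "?e (smult r p) = h r * ?e p" for r p
    using poly_map_poly_simps(2)[of "[:r:]" p t] by (simp add: map_poly_pCons)
  have H: "?e (H p) = ?e d ^ n * poly (map_poly h p) g" if "degree p \<le> n" for p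
  proof -
    have "degree (map_poly h p) = degree p" by (intro degree_map_poly nonzero)
    then have "poly (map_poly h p) g = (\<Sum>i\<le>degree p. h (coeff p i) * g ^ i)"
      by (simp add: poly_altdef coeff_map_poly)
    also have "\<dots> = (\<Sum>i\<le>n. h (coeff p i) * g ^ i)"
      using that by (intro sum.mono_neutral_left) (auto simp: coeff_eq_0)
    finally have "?e d ^ n * poly (map_poly h p) g = (\<Sum>i\<le>n. ?e d ^ n * (h (coeff p i) * g ^ i))"
      by (simp add: sum_distrib_left)
    also have "\<dots> = (\<Sum>i\<le>n. h (coeff p i) * (?e c ^ i * ?e d ^ (n - i)))"
    proof (intro sum.cong refl)
      fix i assume "i \<in> {..n}"
      then have "?e d ^ n = ?e d ^ i * ?e d ^ (n - i)" by (simp flip: power_add)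
      then show "?e d ^ n * (h (coeff p i) * g ^ i) = h (coeff p i) * (?e c ^ i * ?e d ^ (n - i))"
        using dt by (simp add: g power_divide)
    qed
    also have "\<dots> = ?e (H p)"
      by (simp add: H_def poly_map_poly_simps sm pw)
    finally show ?thesis by simp
  qed
  have "poly (map_poly h a) g = t * poly (map_poly h b) g" using inv bg by (simp add: divide_eq_eq)
  then have "?e (H a) = ?e ([:0, 1:] * H b)"
    unfolding poly_map_poly_simps by (simp add: H n_def map_poly_pCons algebra_simps)
  then have "?e (H a - [:0, 1:] * H b) = 0"
    using poly_map_poly_simps(1)[of "H a - [:0, 1:] * H b" "[:0, 1:] * H b" t] by simp
  then have root: "H a = [:0, 1:] * H b" using t by (metis eq_iff_diff_eq_0)
  define l where "l i = [:coeff a i, - coeff b i:]" for i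
  define summand where "summand i = l i * (c ^ i * d ^ (n - i))" for i
  have smult_conv: "smult r p = [:r:] * p" for r and p :: "real poly" by simp
  have l: "l i = [:coeff a i:] - [:0, 1:] * [:coeff b i:]" for i by (simp add: l_def)
  have "(\<Sum>i\<le>n. summand i) = (\<Sum>i\<le>n. smult (coeff a i) (c ^ i * d ^ (n - i)) -
      [:0, 1:] * smult (coeff b i) (c ^ i * d ^ (n - i)))"
    unfolding summand_def l by (intro sum.cong refl) (simp only: left_diff_distrib mult.assoc smult_conv)
  also have "\<dots> = H a - [:0, 1:] * H b"
    unfolding H_def sum_distrib_left sum_subtractf ..
  finally have sum0: "(\<Sum>i\<le>n. summand i) = 0" using root by simp
  have "c dvd summand i" if "i \<noteq> 0" for i
    using that unfolding summand_def by (intro dvd_mult dvd_mult2 dvd_power) auto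
  then have "c dvd (\<Sum>i\<in>{..n} - {0}. summand i)" by (intro dvd_sum) auto
  moreover have "(\<Sum>i\<le>n. summand i) = summand 0 + (\<Sum>i\<in>{..n} - {0}. summand i)"
    by (rule sum.remove) auto
  ultimately have "c dvd summand 0" using sum0 by (metis dvd_0_right dvd_add_left_iff)
  then have "c dvd l 0" unfolding summand_def using cop(2)
    by (simp add: coprime_dvd_mult_left_iff)
  moreover have "l 0 \<noteq> 0"
  proof
    assume "l 0 = 0"
    then have "coeff a 0 = 0" "coeff b 0 = 0" by (auto simp: l_def)
    then have "[:0, 1:] dvd a" "[:0, 1:] dvd b" by (simp_all add: poly_eq_0_iff_dvd[of _ 0, simplified, symmetric] poly_0_coeff_0)
    then have "is_unit [:0, 1 :: real:]" using cop(1) by (meson coprime_common_divisor)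
    then show False by (simp add: is_unit_pCons_iff)
  qed
  ultimately have "degree c \<le> degree (l 0)" by (rule dvd_imp_degree_le)
  moreover have "d dvd summand i" if "i \<in> {..n} - {n}" for i
    using that unfolding summand_def by (intro dvd_mult dvd_power) auto
  then have "d dvd (\<Sum>i\<in>{..n} - {n}. summand i)" by (intro dvd_sum) auto
  moreover have "(\<Sum>i\<le>n. summand i) = summand n + (\<Sum>i\<in>{..n} - {n}. summand i)"
    by (rule sum.remove) auto
  ultimately have "d dvd summand n" using sum0 by (metis dvd_0_right dvd_add_left_iff)
  then have "d dvd l n" unfolding summand_def using cop(2)
    by (simp add: coprime_dvd_mult_left_iff coprime_commute)
  moreover have "l n \<noteq> 0"
  proof
    assume "l n = 0"
    then have "coeff a n = 0" "coeff b n = 0" by (auto simp: l_def)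
    moreover have "b \<noteq> 0" using bg by auto
    ultimately have "n = degree a" "a = 0" unfolding n_def by (auto simp: max_def split: if_splits)
    then have "n = degree b" by (simp add: n_def)
    with \<open>coeff b n = 0\<close> \<open>b \<noteq> 0\<close> show False by simp
  qed
  ultimately have "degree d \<le> degree (l n)" by (intro dvd_imp_degree_le)
  moreover have "degree (l i) \<le> 1" for i by (simp add: l_def)
  ultimately show ?thesis
    by (meson \<open>degree c \<le> degree (l 0)\<close> le_trans)
qed

text \<open>
A homogeneous birational map acts on the ratio of the coordinates, and its inverse acts by the
inverse map of the projective line, so that the criterion above applies.
\<close>

lemma inverse_ratio_degree_le_1:
  assumes lm: "inverse_maps l m" and hl: "homogeneous 1 (fst l)" "homogeneous 1 (snd l)"
  obtains c d where "d \<noteq> 0" "degree c \<le> 1" "degree d \<le> 1"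
    "fst l / snd l = poly (map_poly const2 c) (X / Y) / poly (map_poly const2 d) (X / Y)"
proof -
  have g: "generic const2 l" using inverse_maps_generic[OF lm] by blast
  have "homogeneous 0 (fst l / snd l)" using homogeneous_divide[OF hl] by simp
  then obtain c d where cd: "d \<noteq> 0" "coprime c d"
    "fst l / snd l = poly (map_poly const2 c) (X / Y) / poly (map_poly const2 d) (X / Y)"
    by (rule homogeneous_0_ratio)
  have "homogeneous 0 (fst m / snd m)"
    using homogeneous_divide[of 1 "fst m" 1 "snd m"] homogeneous_inverse[OF lm hl] by simp
  then obtain a b where ab: "b \<noteq> 0" "coprime a b"
    "fst m / snd m = poly (map_poly const2 a) (X / Y) / poly (map_poly const2 b) (X / Y)"
    by (rule homogeneous_0_ratio)
  have T: "rf_value const2 (X / Y) l = fst l / snd l"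
    by (simp add: const2.rf_value_hom(5)[OF g] const2.rf_value_simps)
  have "m \<circ>\<^sub>R l = (X, Y)" using lm by (simp add: inverse_maps_def)
  then have "rf_value const2 (fst m / snd m) l = X / Y"
    by (simp add: const2.rf_value_hom(5)[OF g] rcomp_def map_value_def)
  then have "poly (map_poly const2 a) (fst l / snd l) / poly (map_poly const2 b) (fst l / snd l) = X / Y"
    unfolding ab(3) const2.rf_value_hom(5)[OF g, of "poly _ _"] const2.rf_value_hom(8)[OF g] T .
  moreover have "poly (map_poly const2 b) (fst l / snd l) \<noteq> 0"
    using const2.rf_value_eq_0_iff[OF g, of "poly (map_poly const2 b) (X / Y)"] ab(1)
    unfolding const2.rf_value_hom(8)[OF g] T by (simp add: poly_ratio_eq_0_iff)
  ultimately have "degree c \<le> 1 \<and> degree d \<le> 1"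
    using ab(2) cd by (intro left_invertible_degree_le_1[OF const2.real_hom_axioms, where t = "X / Y" and a = a and b = b])
      (simp_all add: poly_ratio_eq_0_iff)
  then show ?thesis using that cd by blast
qed

lemma inverse_maps_i0: "inverse_maps i0 i0"
  unfolding i0_def
  using const2.evals_X[of "(Y, X)"] const2.evals_Y[of "(Y, X)"] by (intro inverse_mapsI) simp_all

lemma generic_i0: "generic const2 i0"
  using inverse_maps_generic[OF inverse_maps_i0] by blast

lemma generic_ratio_not_const:
  assumes "generic const2 l"
  shows "fst l / snd l \<noteq> const2 r"
proof
  assume "fst l / snd l = const2 r"
  moreover have "fst l / snd l = rf_value const2 (X / Y) l"
    by (simp add: const2.rf_value_hom(5)[OF assms] const2.rf_value_simps)
  ultimately have "rf_value const2 (X / Y - const2 r) l = 0"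
    by (simp add: const2.rf_value_hom(3)[OF assms] const2.rf_value_simps)
  then have "X / Y - const2 r = 0" using const2.rf_value_eq_0_iff[OF assms] by blast
  then have "poly (map_poly const2 [:- r, 1:]) (X / Y) = 0"
    by (simp add: map_poly_pCons const2_hom const2.uminus)
  then show False unfolding poly_ratio_eq_0_iff by simp
qed

text \<open>
Exchanging \<open>x\<close> and \<open>y\<close> inverts \<open>t = x/y\<close>. Comparing coefficients in \<open>g(1/t) = - g(t)\<close> for a
nonconstant fractional linear \<open>g(t) = (c\<^sub>0 + c\<^sub>1 t)/(d\<^sub>0 + d\<^sub>1 t)\<close> forces \<open>d\<^sub>0\<^sup>2 = d\<^sub>1\<^sup>2\<close>, and the two signs give the two
shapes of \<open>g\<close>. They are where the two families \<open>Phi N\<close> and \<open>Phi (- N)\<close> come from.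
\<close>

lemma odd_ratio:
  assumes lm: "inverse_maps l m" and hl: "homogeneous 1 (fst l)" "homogeneous 1 (snd l)"
    and odd: "rf_value const2 (fst l / snd l) i0 = - (fst l / snd l)"
  obtains r where "r \<noteq> 0"
    "fst l / snd l = const2 r * ((X - Y) / (X + Y)) \<or> fst l / snd l = const2 r * ((X + Y) / (X - Y))"
proof -
  have g: "generic const2 l" using inverse_maps_generic[OF lm] by blast
  obtain c d where cd: "d \<noteq> 0" "degree c \<le> 1" "degree d \<le> 1"
    "fst l / snd l = poly (map_poly const2 c) (X / Y) / poly (map_poly const2 d) (X / Y)"
    by (rule inverse_ratio_degree_le_1[OF lm hl])
  define T where "T = X / Y"
  note nz = coordinates_nonzero
  have T0: "T \<noteq> 0" using nz by (simp add: T_def)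
  let ?e = "\<lambda>p::real poly. poly (map_poly const2 p)"
  have linear: "p = [:coeff p 0, coeff p 1:]" if "degree p \<le> 1" for p :: "real poly"
    using that by (intro poly_eqI) (auto simp: coeff_pCons coeff_eq_0 split: nat.splits)
  obtain c0 c1 d0 d1 where c: "c = [:c0, c1:]" and d: "d = [:d0, d1:]"
    using linear[OF cd(2)] linear[OF cd(3)] by blast
  have e_linear: "?e [:a, b:] t = const2 a + t * const2 b" for a b t
    by (simp add: map_poly_pCons)
  have g_eq: "fst l / snd l = (const2 c0 + T * const2 c1) / (const2 d0 + T * const2 d1)"
    using cd(4) unfolding c d e_linear T_def .
  have den: "const2 d0 + T * const2 d1 \<noteq> 0"
    using cd(1) poly_ratio_eq_0_iff[of d] unfolding d e_linear T_def by simp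

  have T_i0: "rf_value const2 T i0 = inverse T"
    unfolding T_def const2.rf_value_hom(5)[OF generic_i0] const2.rf_value_simps
    by (simp add: i0_def)
  have g_i0: "rf_value const2 (fst l / snd l) i0 =
      (const2 c0 + inverse T * const2 c1) / (const2 d0 + inverse T * const2 d1)"
    unfolding g_eq by (simp add: const2.rf_value_hom[OF generic_i0] const2.rf_value_simps T_i0)
  have den': "const2 d0 + inverse T * const2 d1 \<noteq> 0"
    using den const2.rf_value_eq_0_iff[OF generic_i0, of "const2 d0 + T * const2 d1"]
    by (simp add: const2.rf_value_hom[OF generic_i0] const2.rf_value_simps T_i0)
  have flip: "T * (const2 a + inverse T * const2 b) = const2 b + T * const2 a" for a b
    using T0 by (simp add: field_simps)
  have "(const2 c0 + inverse T * const2 c1) * (const2 d0 + T * const2 d1) =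
      - (const2 c0 + T * const2 c1) * (const2 d0 + inverse T * const2 d1)"
    using odd unfolding g_i0 unfolding g_eq minus_divide_left frac_eq_eq[OF den' den] .
  then have "T * (const2 c0 + inverse T * const2 c1) * (const2 d0 + T * const2 d1) +
      (const2 c0 + T * const2 c1) * (T * (const2 d0 + inverse T * const2 d1)) = 0"
    by (simp only: mult.assoc mult.left_commute[of "const2 c0 + T * const2 c1" T] mult_minus_left
        mult_minus_right add.left_inverse)
  then have "?e ([:c1, c0:] * [:d0, d1:] + [:c0, c1:] * [:d1, d0:]) T = 0"
    unfolding flip const2.poly_map_poly_simps e_linear .
  then have "[:c1, c0:] * [:d0, d1:] + [:c0, c1:] * [:d1, d0:] = 0"
    unfolding T_def poly_ratio_eq_0_iff .
  then have e1: "c1 * d0 = - (c0 * d1)" and e2: "c1 * d1 = - (c0 * d0)"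
    by (simp_all add: eq_neg_iff_add_eq_0 mult.commute)

  have ne: "c0 * d1 \<noteq> c1 * d0"
  proof
    assume eq: "c0 * d1 = c1 * d0"
    obtain r where r: "c0 = r * d0" "c1 = r * d1"
    proof (cases "d1 = 0")
      case True
      then show ?thesis using that[of "c0 / d0"] eq cd(1) d by auto
    next
      case False
      then show ?thesis using that[of "c1 / d1"] eq by (auto simp: field_simps)
    qed
    have "const2 c0 + T * const2 c1 = const2 r * (const2 d0 + T * const2 d1)"
      by (simp add: r const2_hom algebra_simps)
    then have "fst l / snd l = const2 r" unfolding g_eq using den by simp
    then show False using generic_ratio_not_const[OF g] by blast
  qed
  then have nz': "c0 \<noteq> 0" "c1 \<noteq> 0" "d0 \<noteq> 0" "d1 \<noteq> 0" using e1 by auto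
  have "c1 * d0\<^sup>2 = c1 * d1\<^sup>2"
  proof -
    have "c1 * d0\<^sup>2 = (c1 * d0) * d0" by (simp add: power2_eq_square)
    also have "\<dots> = - (c0 * d0) * d1" unfolding e1 by simp
    also have "\<dots> = c1 * d1\<^sup>2" unfolding e2[symmetric] by (simp add: power2_eq_square)
    finally show ?thesis .
  qed
  then have "d0 = d1 \<or> d0 = - d1" using nz'(2) by (simp add: power2_eq_iff)
  then show ?thesis
  proof
    assume d: "d0 = d1"
    then have "c1 * d1 = (- c0) * d1" using e1 by simp
    then have "c0 = - c1" unfolding mult_cancel_right using nz' by simp
    then have "fst l / snd l = (const2 c1 * (T - 1)) / (const2 d1 * (T + 1))"
      unfolding g_eq d by (simp add: const2.uminus algebra_simps)
    also have "(T - 1) / (T + 1) = (X - Y) / (X + Y)"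
      using nz sum_diff_nonzero by (simp add: T_def divide_simps)
    then have "(const2 c1 * (T - 1)) / (const2 d1 * (T + 1)) = const2 c1 / const2 d1 * ((X - Y) / (X + Y))"
      by (simp only: times_divide_times_eq[symmetric])
    also have "const2 c1 / const2 d1 = const2 (c1 / d1)" using nz' const2.nonzero[of d1]
      by (simp add: divide_eq_eq flip: const2_hom)
    finally show ?thesis using that[of "c1 / d1"] nz' by simp
  next
    assume d: "d0 = - d1"
    then have "c1 * d1 = c0 * d1" using e1 by simp
    then have "c0 = c1" unfolding mult_cancel_right using nz' by simp
    then have "fst l / snd l = (const2 c1 * (T + 1)) / (const2 d1 * (T - 1))"
      unfolding g_eq d by (simp add: const2.uminus algebra_simps)
    also have "(T + 1) / (T - 1) = (X + Y) / (X - Y)"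
      using nz sum_diff_nonzero by (simp add: T_def divide_simps)
    then have "(const2 c1 * (T + 1)) / (const2 d1 * (T - 1)) = const2 c1 / const2 d1 * ((X + Y) / (X - Y))"
      by (simp only: times_divide_times_eq[symmetric])
    also have "const2 c1 / const2 d1 = const2 (c1 / d1)" using nz' const2.nonzero[of d1]
      by (simp add: divide_eq_eq flip: const2_hom)
    finally show ?thesis using that[of "c1 / d1"] nz' by simp
  qed
qed

section \<open>The symmetric flows of a given level\<close>

lemma rcomp_cancel:
  assumes "inverse_maps l m" "generic const2 w"
  shows "l \<circ>\<^sub>R (m \<circ>\<^sub>R w) = w"
  using assms rcomp_assoc[of m w l] by (simp add: inverse_maps_iff_generic)

lemma Phi_conj_phi:
  assumes "M \<in> {N, - N}"
  obtains k n where "inverse_maps k n" "homogeneous 1 (fst k)" "homogeneous 1 (snd k)"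
    "n \<circ>\<^sub>R (phi N \<circ>\<^sub>R k) = Phi M"
    "k = (X - Y, X + Y) \<and> M = - N \<or> k = ((X + Y)\<^sup>2 / (X - Y), X + Y) \<and> M = N"
proof (cases "M = - N")
  case True
  then show ?thesis
    using that[OF inverse_maps_half_sum_diff] homogeneous_sum_diff Phi_minus_conj by simp
next
  case False
  then show ?thesis
    using assms that[OF inverse_maps_square_over_diff] homogeneous_sum_diff homogeneous_square_over_diff
      Phi_plus_conj by simp
qed

lemma inverse_maps_scale_X:
  assumes "r \<noteq> 0"
  shows "inverse_maps (const2 r * X, Y) (const2 (1 / r) * X, Y)"
proof -
  have r: "const2 r * (const2 (1 / r) * X) = X" "const2 (1 / r) * (const2 r * X) = X"
    using assms by (simp_all add: const2_hom flip: mult.assoc const2_hom(4))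
  show ?thesis
    by (rule inverse_mapsI; unfold fst_conv snd_conv; rule const2.evals_cong)
      ((rule const2.evals_intros | (simp add: r; fail))+)
qed

lemma phi_commutes_scale_X:
  assumes "r \<noteq> 0"
  shows "phi N \<circ>\<^sub>R (const2 r * X, Y) = (const2 r * X, Y) \<circ>\<^sub>R phi N"
proof -
  have g: "generic const2 (const2 r * X, Y)"
    using inverse_maps_generic[OF inverse_maps_scale_X[OF assms]] by blast
  have "phi N \<circ>\<^sub>R (const2 r * X, Y) = (const2 r * X * (Y + 1) powi (N - 1), Y / (Y + 1))"
    using const2.map_value_phi[OF g] by (simp add: rcomp_def)
  moreover have "(const2 r * X, Y) \<circ>\<^sub>R phi N = (const2 r * fst (phi N), snd (phi N))"
    by (simp add: rcomp_def map_value_def const2.rf_value_hom[OF generic_phi] const2.rf_value_simps)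
  ultimately show ?thesis by (simp add: phi_def mult.assoc)
qed

text \<open>
The factor \<open>s\<close> disappears because it commutes with \<open>phi N\<close>; what remains of the conjugation by
\<open>k \<circ> L\<close> is the conjugation by \<open>L\<close> of the conjugate \<open>P\<close> of \<open>phi N\<close> by \<open>k\<close>.
\<close>

lemma conj_decomposition:
  assumes s: "r \<noteq> 0" "s = (const2 r * X, Y)" and kn: "inverse_maps k n"
    and L: "inverse_maps L L'" and Phi: "n \<circ>\<^sub>R (phi N \<circ>\<^sub>R k) = P"
  shows "rinv (s \<circ>\<^sub>R (k \<circ>\<^sub>R L)) \<circ>\<^sub>R phi N \<circ>\<^sub>R (s \<circ>\<^sub>R (k \<circ>\<^sub>R L)) = rinv L \<circ>\<^sub>R P \<circ>\<^sub>R L"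
proof -
  define s' where "s' = (const2 (1 / r) * X, Y)"
  have ss: "inverse_maps s s'" unfolding s s'_def by (rule inverse_maps_scale_X[OF s(1)])
  have g [simp]: "generic const2 s" "generic const2 s'" "generic const2 k" "generic const2 n"
    "generic const2 L" "generic const2 L'" "generic const2 (phi N)"
    using inverse_maps_generic[OF ss] inverse_maps_generic[OF kn] inverse_maps_generic[OF L]
      generic_phi by auto
  have "inverse_maps (s \<circ>\<^sub>R (k \<circ>\<^sub>R L)) (L' \<circ>\<^sub>R n \<circ>\<^sub>R s')"
    by (intro inverse_maps_rcomp ss kn L)
  then have "rinv (s \<circ>\<^sub>R (k \<circ>\<^sub>R L)) \<circ>\<^sub>R phi N \<circ>\<^sub>R (s \<circ>\<^sub>R (k \<circ>\<^sub>R L)) =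
      L' \<circ>\<^sub>R (n \<circ>\<^sub>R (s' \<circ>\<^sub>R ((phi N \<circ>\<^sub>R s) \<circ>\<^sub>R (k \<circ>\<^sub>R L))))"
    by (simp add: rinv_eq rcomp_assoc generic_rcomp)
  also have "(phi N \<circ>\<^sub>R s) \<circ>\<^sub>R (k \<circ>\<^sub>R L) = s \<circ>\<^sub>R (phi N \<circ>\<^sub>R (k \<circ>\<^sub>R L))"
    using phi_commutes_scale_X[OF s(1), of N] unfolding s(2)[symmetric]
    by (simp add: rcomp_assoc generic_rcomp)
  also have "s' \<circ>\<^sub>R (s \<circ>\<^sub>R (phi N \<circ>\<^sub>R (k \<circ>\<^sub>R L))) = phi N \<circ>\<^sub>R (k \<circ>\<^sub>R L)"
    by (rule rcomp_cancel[OF inverse_maps_sym[OF ss]]) (intro generic_rcomp g)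
  also have "L' \<circ>\<^sub>R (n \<circ>\<^sub>R (phi N \<circ>\<^sub>R (k \<circ>\<^sub>R L))) = L' \<circ>\<^sub>R P \<circ>\<^sub>R L"
    unfolding Phi[symmetric] by (simp add: rcomp_assoc generic_rcomp)
  finally show ?thesis by (simp add: rinv_eq[OF L])
qed

text \<open>
\<open>Phi M\<close> is a conjugate of \<open>phi N\<close> by a 1-BIR, hence so is \<open>\<phi>\<close>; and the swap \<open>i0\<close> commutes with
\<open>Phi M\<close> and, as \<open>A\<close> is symmetric, with the scaling by \<open>A\<close>.
\<close>

lemma symmetric_form_is_flow:
  assumes M: "M \<in> {N, - N}" and N: "N \<ge> 0"
    and A: "A \<noteq> 0" "homogeneous 0 A" "symmetric A"
    and \<phi>: "\<phi> = rinv (X * A, Y * A) \<circ>\<^sub>R Phi M \<circ>\<^sub>R (X * A, Y * A)"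
  shows "has_level \<phi> N \<and> i0 \<circ>\<^sub>R \<phi> \<circ>\<^sub>R i0 = \<phi>"
proof
  define L L' where "L = (X * A, Y * A)" and "L' = (X / A, Y / A)"
  have LL: "inverse_maps L L'" unfolding L_def L'_def by (rule inverse_maps_scaling[OF A(2,1)])
  obtain k n where kn: "inverse_maps k n" "homogeneous 1 (fst k)" "homogeneous 1 (snd k)"
    "n \<circ>\<^sub>R (phi N \<circ>\<^sub>R k) = Phi M"
    by (rule Phi_conj_phi[OF M])
  have g [simp]: "generic const2 k" "generic const2 n" "generic const2 L" "generic const2 L'"
    "generic const2 (phi N)" "generic const2 i0"
    using inverse_maps_generic[OF kn(1)] inverse_maps_generic[OF LL] generic_phi generic_i0 by auto
  have gP [simp]: "generic const2 (Phi M)"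
    unfolding kn(4)[symmetric] by (intro generic_rcomp) simp_all
  define l where "l = k \<circ>\<^sub>R L"
  have lm: "inverse_maps l (L' \<circ>\<^sub>R n)" unfolding l_def by (intro inverse_maps_rcomp kn LL)
  have hL: "homogeneous 1 (fst L)" "homogeneous 1 (snd L)"
    using homogeneous_mult[OF homogeneous_X A(2)] homogeneous_mult[OF homogeneous_Y A(2)]
    by (simp_all add: L_def)
  have hl: "homogeneous 1 (fst l)" "homogeneous 1 (snd l)"
    using kn(2,3) hL by (simp_all add: l_def rcomp_def map_value_def homogeneous_rcomp)
  have one: "(const2 1 * X, Y) = (X, Y)" by (simp add: const2_hom)
  have conj: "\<phi> = rinv l \<circ>\<^sub>R phi N \<circ>\<^sub>R l"
    using conj_decomposition[OF _ refl kn(1) LL kn(4), of 1]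
    unfolding one rcomp_XY_left l_def[symmetric] unfolding \<phi> L_def[symmetric] by simp
  moreover have "flow (rinv l \<circ>\<^sub>R phi N \<circ>\<^sub>R l)"
    unfolding rinv_eq[OF lm] by (rule conj_phi_flow[OF lm hl])
  moreover have "one_BIR l" unfolding one_BIR_def birational_def using lm hl by blast
  ultimately show "has_level \<phi> N" unfolding has_level_def using N by blast

  have A_i0: "rf_value const2 A i0 = A" using A(3) by (simp add: symmetric_def i0_def)
  have L_i0: "L \<circ>\<^sub>R i0 = i0 \<circ>\<^sub>R L" and L'_i0: "L' \<circ>\<^sub>R i0 = i0 \<circ>\<^sub>R L'"
    by (simp_all add: rcomp_def map_value_def L_def L'_def const2.rf_value_hom[OF g(6)]
        const2.rf_value_simps A_i0) (simp_all add: i0_def const2.rf_value_simps)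
  have P_i0: "Phi M \<circ>\<^sub>R i0 = i0 \<circ>\<^sub>R Phi M"
    by (simp add: rcomp_def map_value_def Phi_def const2.rf_value_hom[OF g(6)]
        const2.rf_value_simps const2.rf_value_numeral[OF g(6)])
      (simp add: i0_def const2.rf_value_simps add_ac)
  have "i0 \<circ>\<^sub>R \<phi> \<circ>\<^sub>R i0 = i0 \<circ>\<^sub>R (L' \<circ>\<^sub>R (Phi M \<circ>\<^sub>R (L \<circ>\<^sub>R i0)))"
    unfolding \<phi> L_def[symmetric] rinv_eq[OF LL] by (simp add: rcomp_assoc generic_rcomp)
  also have "\<dots> = (i0 \<circ>\<^sub>R L') \<circ>\<^sub>R ((Phi M \<circ>\<^sub>R i0) \<circ>\<^sub>R L)"
    unfolding L_i0 by (simp add: rcomp_assoc generic_rcomp)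
  also have "\<dots> = L' \<circ>\<^sub>R (i0 \<circ>\<^sub>R (i0 \<circ>\<^sub>R (Phi M \<circ>\<^sub>R L)))"
    unfolding P_i0 L'_i0[symmetric] by (simp add: rcomp_assoc generic_rcomp)
  also have "\<dots> = L' \<circ>\<^sub>R (Phi M \<circ>\<^sub>R L)"
    by (simp add: rcomp_cancel[OF inverse_maps_i0] generic_rcomp)
  also have "\<dots> = \<phi>"
    unfolding \<phi> L_def[symmetric] rinv_eq[OF LL] by (simp add: rcomp_assoc)
  finally show "i0 \<circ>\<^sub>R \<phi> \<circ>\<^sub>R i0 = \<phi>" .
qed

text \<open>
If \<open>\<phi> = m \<circ> phi N \<circ> l\<close> with \<open>m\<close> inverse to \<open>l\<close> commutes with \<open>i0\<close>, then \<open>j = l \<circ> i0 \<circ> m\<close>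
commutes with \<open>phi N\<close>. The centraliser of \<open>phi N\<close> is so small that the involution \<open>j \<noteq> id\<close> can only be
\<open>(- x, y)\<close>, so the first component of \<open>l\<close> is antisymmetric and the second one is symmetric. Up to
a constant their ratio is then one of two functions, and the second component determines \<open>A\<close>.
\<close>

lemma symmetric_flow_has_form:
  assumes N: "N \<ge> 2" and lev: "has_level \<phi> N" and sym: "i0 \<circ>\<^sub>R \<phi> \<circ>\<^sub>R i0 = \<phi>"
  obtains M A where "M \<in> {N, - N}" "A \<noteq> 0" "homogeneous 0 A" "symmetric A"
    "\<phi> = rinv (X * A, Y * A) \<circ>\<^sub>R Phi M \<circ>\<^sub>R (X * A, Y * A)"
proof -
  obtain l where l: "one_BIR l" "\<phi> = rinv l \<circ>\<^sub>R phi N \<circ>\<^sub>R l"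
    using lev by (auto simp: has_level_def)
  then obtain m where lm: "inverse_maps l m" by (auto simp: one_BIR_def birational_def)
  have hl: "homogeneous 1 (fst l)" "homogeneous 1 (snd l)" using l(1) by (simp_all add: one_BIR_def)
  have hm: "homogeneous 1 (fst m)" "homogeneous 1 (snd m)" using homogeneous_inverse[OF lm hl] by simp_all
  note ml = inverse_maps_sym[OF lm]
  have g [simp]: "generic const2 l" "generic const2 m" "generic const2 (phi N)" "generic const2 i0"
    using inverse_maps_generic[OF lm] generic_phi generic_i0 by auto
  have \<phi>: "\<phi> = m \<circ>\<^sub>R phi N \<circ>\<^sub>R l" using l(2) rinv_eq[OF lm] by simp
  have g\<phi> [simp]: "generic const2 \<phi>" unfolding \<phi> by (intro generic_rcomp g)

  define j where "j = l \<circ>\<^sub>R (i0 \<circ>\<^sub>R m)"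
  have gj [simp]: "generic const2 j" unfolding j_def by (intro generic_rcomp g)
  have i0m: "i0 \<circ>\<^sub>R m = (snd m, fst m)" by (simp add: i0_def rcomp_def map_value_def const2.rf_value_simps)
  have hj: "homogeneous 1 (fst j)" "homogeneous 1 (snd j)"
    using homogeneous_rcomp[of _ "i0 \<circ>\<^sub>R m"] hl hm generic_rcomp[of i0 m]
    by (simp_all add: j_def rcomp_def[of l] map_value_def i0m)
  have l\<phi>: "l \<circ>\<^sub>R \<phi> = phi N \<circ>\<^sub>R l" 
    unfolding \<phi> by (simp add: rcomp_assoc generic_rcomp rcomp_cancel[OF lm])
  have \<phi>m: "\<phi> \<circ>\<^sub>R m = m \<circ>\<^sub>R phi N"
    using lm unfolding \<phi> by (simp add: rcomp_assoc generic_rcomp inverse_maps_rcomp_eq)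
  have \<phi>i0: "\<phi> \<circ>\<^sub>R i0 = i0 \<circ>\<^sub>R \<phi>"
    using rcomp_cancel[OF inverse_maps_i0, of "\<phi> \<circ>\<^sub>R i0"] sym by (simp add: rcomp_assoc generic_rcomp)
  have "phi N \<circ>\<^sub>R j = (l \<circ>\<^sub>R \<phi>) \<circ>\<^sub>R (i0 \<circ>\<^sub>R m)"
    unfolding l\<phi> j_def by (simp add: rcomp_assoc generic_rcomp)
  also have "\<dots> = l \<circ>\<^sub>R ((\<phi> \<circ>\<^sub>R i0) \<circ>\<^sub>R m)" by (simp add: rcomp_assoc generic_rcomp)
  also have "\<dots> = l \<circ>\<^sub>R (i0 \<circ>\<^sub>R (\<phi> \<circ>\<^sub>R m))" unfolding \<phi>i0 by (simp add: rcomp_assoc generic_rcomp)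
  also have "\<dots> = j \<circ>\<^sub>R phi N" unfolding \<phi>m j_def by (simp add: rcomp_assoc generic_rcomp)
  finally obtain c where c: "j = (const2 c * X, Y)" using centraliser_phi[OF N gj hj] by blast

  have jl: "j \<circ>\<^sub>R l = l \<circ>\<^sub>R i0"
    using ml unfolding j_def by (simp add: rcomp_assoc generic_rcomp inverse_maps_rcomp_eq)
  have "j \<circ>\<^sub>R j = l \<circ>\<^sub>R (i0 \<circ>\<^sub>R (m \<circ>\<^sub>R (l \<circ>\<^sub>R (i0 \<circ>\<^sub>R m))))"
    unfolding j_def by (simp add: rcomp_assoc generic_rcomp)
  also have "\<dots> = (X, Y)"
    using lm by (simp add: rcomp_cancel[OF ml] rcomp_cancel[OF inverse_maps_i0] generic_rcomp inverse_maps_rcomp_eq)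
  finally have "const2 c * (const2 c * X) = X"
    using gj unfolding c by (simp add: rcomp_def map_value_def const2.rf_value_hom const2.rf_value_simps)
  then have "const2 (c * c) = const2 1" using coordinates_nonzero(2) by (simp add: const2_hom flip: mult.assoc)
  then have "c * c = 1" using const2.inj by blast
  moreover have "c \<noteq> 1"
  proof
    assume "c = 1"
    then have "l \<circ>\<^sub>R i0 = l" using jl c by (simp add: const2_hom)
    then have "i0 = (X, Y)" using rcomp_cancel[OF ml g(4)] ml by (simp add: inverse_maps_rcomp_eq)
    then have "X = Y" unfolding i0_def by (rule Pair_inject)
    then show False using sum_diff_nonzero(2) by (metis diff_self)
  qed
  ultimately have "c = - 1" by (simp add: square_eq_1_iff)
  then have j: "j = (- X, Y)" using c by (simp add: const2.uminus const2_hom)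
  have fst_i0: "rf_value const2 (fst l) i0 = - fst l" and snd_i0: "rf_value const2 (snd l) i0 = snd l"
    using jl unfolding j
    by (simp_all add: rcomp_def map_value_def const2.rf_value_hom[OF g(1)] const2.rf_value_simps)

  define A where "A = snd l / (X + Y)"
  note nz = sum_diff_nonzero
  have l0: "snd l \<noteq> 0" using const2.generic_nonzero[OF g(1)] by simp
  have A0: "A \<noteq> 0" using l0 nz by (simp add: A_def)
  have hA: "homogeneous 0 A"
    unfolding A_def using homogeneous_divide[OF hl(2) homogeneous_sum_diff(1)] by simp
  have A_i0: "rf_value const2 A i0 = A"
    unfolding A_def const2.rf_value_hom[OF g(4)] snd_i0 const2.rf_value_simps
    by (simp add: i0_def add.commute)
  define L L' where "L = (X * A, Y * A)" and "L' = (X / A, Y / A)"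
  have LL: "inverse_maps L L'" unfolding L_def L'_def by (rule inverse_maps_scaling[OF hA A0])
  have gL: "generic const2 L" using inverse_maps_generic[OF LL] by blast
  have "rf_value const2 (fst l / snd l) i0 = - (fst l / snd l)"
    by (simp add: const2.rf_value_hom(5)[OF g(4)] fst_i0 snd_i0)
  then obtain r where r: "r \<noteq> 0"
    "fst l / snd l = const2 r * ((X - Y) / (X + Y)) \<or> fst l / snd l = const2 r * ((X + Y) / (X - Y))"
    by (rule odd_ratio[OF lm hl])
  have snd_l: "snd l = (X + Y) * A" using nz by (simp add: A_def)
  have fst_l: "fst l = fst l / snd l * snd l" using l0 by simp
  have "\<exists>M\<in>{N, - N}. \<exists>k n. inverse_maps k n \<and> n \<circ>\<^sub>R (phi N \<circ>\<^sub>R k) = Phi M \<and>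
      l = (const2 r * X, Y) \<circ>\<^sub>R (k \<circ>\<^sub>R L)"
    using r(2)
  proof
    assume q: "fst l / snd l = const2 r * ((X - Y) / (X + Y))"
    have "(X - Y, X + Y) \<circ>\<^sub>R L = ((X - Y) * A, (X + Y) * A)"
      using gL by (simp add: rcomp_def map_value_def const2.rf_value_hom const2.rf_value_simps)
        (simp add: L_def algebra_simps)
    moreover have "generic const2 ((X - Y, X + Y) \<circ>\<^sub>R L)"
      using inverse_maps_generic[OF inverse_maps_half_sum_diff] gL by (intro generic_rcomp) auto
    moreover have "fst l = const2 r * ((X - Y) / (X + Y)) * snd l" using fst_l unfolding q .
    then have "fst l = const2 r * ((X - Y) * A)" unfolding snd_l using nz by simp
    ultimately have "l = (const2 r * X, Y) \<circ>\<^sub>R ((X - Y, X + Y) \<circ>\<^sub>R L)"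
      using snd_l by (simp add: rcomp_def[of "(const2 r * X, Y)"] map_value_def const2.rf_value_hom
          const2.rf_value_simps prod_eq_iff)
    then show ?thesis using inverse_maps_half_sum_diff Phi_minus_conj by blast
  next
    assume q: "fst l / snd l = const2 r * ((X + Y) / (X - Y))"
    have "(X * A + Y * A)\<^sup>2 / (X * A - Y * A) = (X + Y)\<^sup>2 / (X - Y) * A"
    proof -
      have "X * A + Y * A = (X + Y) * A" "X * A - Y * A = (X - Y) * A" by (simp_all add: algebra_simps)
      then show ?thesis using A0 by (simp add: power2_eq_square)
    qed
    then have "((X + Y)\<^sup>2 / (X - Y), X + Y) \<circ>\<^sub>R L = ((X + Y)\<^sup>2 / (X - Y) * A, (X + Y) * A)"
      using gL by (simp add: rcomp_def map_value_def const2.rf_value_hom const2.rf_value_simps)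
        (simp add: L_def distrib_right)
    moreover have "generic const2 (((X + Y)\<^sup>2 / (X - Y), X + Y) \<circ>\<^sub>R L)"
      using inverse_maps_generic[OF inverse_maps_square_over_diff] gL by (intro generic_rcomp) auto
    moreover have "fst l = const2 r * ((X + Y) / (X - Y)) * snd l" using fst_l unfolding q .
    then have "fst l = const2 r * ((X + Y)\<^sup>2 / (X - Y) * A)" unfolding snd_l by (simp add: power2_eq_square)
    ultimately have "l = (const2 r * X, Y) \<circ>\<^sub>R (((X + Y)\<^sup>2 / (X - Y), X + Y) \<circ>\<^sub>R L)"
      using snd_l by (simp add: rcomp_def[of "(const2 r * X, Y)"] map_value_def const2.rf_value_hom
          const2.rf_value_simps prod_eq_iff)
    then show ?thesis using inverse_maps_square_over_diff Phi_plus_conj by blast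
  qed
  then obtain M k n where M: "M \<in> {N, - N}" and kn: "inverse_maps k n"
    "n \<circ>\<^sub>R (phi N \<circ>\<^sub>R k) = Phi M" and l_eq: "l = (const2 r * X, Y) \<circ>\<^sub>R (k \<circ>\<^sub>R L)"
    by blast
  have "\<phi> = rinv L \<circ>\<^sub>R Phi M \<circ>\<^sub>R L"
    using conj_decomposition[OF r(1) refl kn(1) LL kn(2)] l(2) unfolding l_eq[symmetric] by simp
  then show ?thesis using that[OF M A0 hA] A_i0 by (simp add: symmetric_def i0_def L_def)
qed

theorem proposition13:
  fixes N :: int
  assumes "N \<ge> 2"
  shows "{\<phi>. flow \<phi> \<and> has_level \<phi> N \<and> i0 \<circ>\<^sub>R \<phi> \<circ>\<^sub>R i0 = \<phi>} =
         {rinv l \<circ>\<^sub>R Phi M \<circ>\<^sub>R l | l M A.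
            M \<in> {N, - N} \<and> A \<noteq> 0 \<and> homogeneous 0 A \<and> symmetric A \<and> l = (X * A, Y * A)}"
proof (intro equalityI subsetI)
  fix \<phi> assume "\<phi> \<in> {\<phi>. flow \<phi> \<and> has_level \<phi> N \<and> i0 \<circ>\<^sub>R \<phi> \<circ>\<^sub>R i0 = \<phi>}"
  then have "has_level \<phi> N" "i0 \<circ>\<^sub>R \<phi> \<circ>\<^sub>R i0 = \<phi>" by simp_all
  then obtain M A where "M \<in> {N, - N}" "A \<noteq> 0" "homogeneous 0 A" "symmetric A"
    "\<phi> = rinv (X * A, Y * A) \<circ>\<^sub>R Phi M \<circ>\<^sub>R (X * A, Y * A)"
    by (rule symmetric_flow_has_form[OF assms])
  then show "\<phi> \<in> {rinv l \<circ>\<^sub>R Phi M \<circ>\<^sub>R l | l M A.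
      M \<in> {N, - N} \<and> A \<noteq> 0 \<and> homogeneous 0 A \<and> symmetric A \<and> l = (X * A, Y * A)}"
    by blast
next
  fix \<phi> assume "\<phi> \<in> {rinv l \<circ>\<^sub>R Phi M \<circ>\<^sub>R l | l M A.
      M \<in> {N, - N} \<and> A \<noteq> 0 \<and> homogeneous 0 A \<and> symmetric A \<and> l = (X * A, Y * A)}"
  then obtain M A where "M \<in> {N, - N}" "A \<noteq> 0" "homogeneous 0 A" "symmetric A"
    "\<phi> = rinv (X * A, Y * A) \<circ>\<^sub>R Phi M \<circ>\<^sub>R (X * A, Y * A)"
    by blast
  then have "has_level \<phi> N \<and> i0 \<circ>\<^sub>R \<phi> \<circ>\<^sub>R i0 = \<phi>"
    using symmetric_form_is_flow assms by simp
  then show "\<phi> \<in> {\<phi>. flow \<phi> \<and> has_level \<phi> N \<and> i0 \<circ>\<^sub>R \<phi> \<circ>\<^sub>R i0 = \<phi>}"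
    by (simp add: has_level_def)
qed

end
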